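(* Let $K$ be an algebraically closed field, and let $V\subset K^{n+2}$ be the simplicial toric variety attached to integers $d>1$, $a_1,\dots,a_n,b_1,\dots,b_n$ as described in the context. Suppose that the following conditions hold. (A) There are indices $i,j\in\{1,\dots,n\}$ such that $a_i=0$, $b_i\neq 0$, $a_j\neq 0$, $b_j=0$. (B) For all $i=1,\dots,n$: (i) $d\mid a_i\Leftrightarrow d\mid b_i$; (ii) $d\nmid a_i\Leftrightarrow \gcd(d,a_i)=1$, and $d\nmid b_i\Leftrightarrow\gcd(d,b_i)=1$. (C) In the matrix of residue classes modulo $d$ $$\begin{pmatrix}\bar a_1&\bar a_2&\cdots&\bar a_n\\ \bar b_1&\bar b_2&\cdots&\bar b_n\end{pmatrix}$$ the rows are proportional, i.e., one of them is an integer multiple of the other. (D) There is an index $i$ such that $\gcd(d,a_i)=1$. Let $p$ be any prime divisor of $d$. If $\operatorname{char}K\neq p$, then $V$ is not a set-theoretic complete intersection.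
   Context: Setting: $n$ is a positive integer, $d$ is a positive integer, and $a_1,\dots,a_n,b_1,\dots,b_n$ are nonnegative integers such that for every index $i$ at least one of $a_i,b_i$ is nonzero, and $\gcd(d,a_1,\dots,a_n,b_1,\dots,b_n)=1$. The variety $V\subset K^{n+2}$ (coordinates $x_1,\dots,x_n,y_1,y_2$) is the set of all points $$x_i=u_i^d\ (i=1,\dots,n),\qquad y_1=u_1^{a_1}u_2^{a_2}\cdots u_n^{a_n},\qquad y_2=u_1^{b_1}u_2^{b_2}\cdots u_n^{b_n},\qquad (u_1,\dots,u_n)\in K^n.$$ It has codimension 2. The arithmetical rank $\operatorname{ara}V$ of an affine variety $V\subset K^N$ is the minimum number of polynomial equations (over $K$, in $N$ variables) whose common zero set in $K^N$ is $V$. One has $\operatorname{ara}V\ge\operatorname{codim}V$, and $V$ is called a set-theoretic complete intersection if equality holds (here: if $\operatorname{ara}V=2$). *)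

theory Defs
  imports
    "HOL-Computational_Algebra.Computational_Algebra"
    "HOL-Number_Theory.Cong"
    "HOL-Library.Poly_Mapping"
    "HOL-Library.FuncSet"
    "HOL-Library.Extended_Nat"
begin

text \<open>
  A polynomial in the variables with indices \<open>1, \<dots>, N\<close> is a finitely supported map from monomials
  to coefficients; a monomial is a finitely supported map from variable indices to exponents.
\<close>

type_synonym 'a mpoly = "(nat \<Rightarrow>\<^sub>0 nat) \<Rightarrow>\<^sub>0 'a"

definition mpolys :: "nat \<Rightarrow> 'a::zero mpoly set" where
  "mpolys N = {f. \<forall>m\<in>Poly_Mapping.keys f. Poly_Mapping.keys m \<subseteq> {1..N}}"

definition mpoly_eval :: "'a::comm_semiring_1 mpoly \<Rightarrow> (nat \<Rightarrow> 'a) \<Rightarrow> 'a" where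
  "mpoly_eval f x =
     (\<Sum>m\<in>Poly_Mapping.keys f. Poly_Mapping.lookup f m *
        (\<Prod>i\<in>Poly_Mapping.keys m. x i ^ Poly_Mapping.lookup m i))"

definition affine_space :: "nat \<Rightarrow> (nat \<Rightarrow> 'a) set" where
  "affine_space N = {1..N} \<rightarrow>\<^sub>E UNIV"

definition zero_set :: "nat \<Rightarrow> 'a::comm_semiring_1 mpoly set \<Rightarrow> (nat \<Rightarrow> 'a) set" where
  "zero_set N F = {x \<in> affine_space N. \<forall>f\<in>F. mpoly_eval f x = 0}"

text \<open>
  The arithmetical rank of \<open>V \<subseteq> K\<^sup>N\<close>: the infimum is an attained minimum if \<open>V\<close> is an algebraic set,
  and it is \<open>\<infinity>\<close> if \<open>V\<close> is not the zero set of finitely many polynomials.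
\<close>

definition arithmetical_rank :: "nat \<Rightarrow> (nat \<Rightarrow> 'a::comm_semiring_1) set \<Rightarrow> enat" where
  "arithmetical_rank N V =
     Inf {enat (card F) | F. finite F \<and> F \<subseteq> mpolys N \<and> zero_set N F = V}"

text \<open>
  For a variety \<open>V \<subseteq> K\<^sup>N\<close> of codimension \<open>c\<close>, being a set-theoretic complete intersection means
  that the arithmetical rank equals \<open>c\<close>. The codimension is supplied as a parameter; it is \<open>2\<close> for
  the varieties below.
\<close>

definition set_theoretic_complete_intersection ::
    "nat \<Rightarrow> nat \<Rightarrow> (nat \<Rightarrow> 'a::comm_semiring_1) set \<Rightarrow> bool" where
  "set_theoretic_complete_intersection c N V \<longleftrightarrow> arithmetical_rank N V = enat c"

text \<open>
  Points of \<open>K\<^sup>n\<^sup>+\<^sup>2\<close> have the coordinates \<open>x\<^sub>1, \<dots>, x\<^sub>n\<close> at the indices \<open>1, \<dots>, n\<close>, then \<open>y\<^sub>1\<close> at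
  index \<open>n + 1\<close> and \<open>y\<^sub>2\<close> at index \<open>n + 2\<close>.
\<close>

definition simplicial_toric_variety ::
    "nat \<Rightarrow> nat \<Rightarrow> (nat \<Rightarrow> nat) \<Rightarrow> (nat \<Rightarrow> nat) \<Rightarrow> (nat \<Rightarrow> 'a::comm_semiring_1) set" where
  "simplicial_toric_variety n d a b =
     (\<lambda>u. \<lambda>i\<in>{1..n + 2}.
        if i \<le> n then u i ^ d
        else if i = n + 1 then \<Prod>j\<in>{1..n}. u j ^ a j
        else \<Prod>j\<in>{1..n}. u j ^ b j) ` affine_space n"

end

(* The proof is Hartshorne's connectedness argument made elementary. Fixing all x_l = 1 except for the
   two indices i, j of condition (A) turns V into the union, over the d-th roots of unity z, of the
   surfaces y_1 = z^(a_k) x_j^alpha, y_2 = z^(b_k) x_i^beta in K^4, where k is the index of (D),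
   alpha = a_j / d and beta = b_i / d. They
   meet pairwise only at the origin, and since char K is not p there are at least two of them. If f, g
   cut out the union, then f, g, x_i, x_j behave like a regular sequence, so a function on
   K[x_i, x_j, y_1, y_2]/(f, g) defined off the origin extends over it; this is contradicted by the
   function equal to 1 on one surface and 0 on the others. Passing from zero sets to ideals uses
   Hilbert's Nullstellensatz, proved one variable at a time. *)

theory Submission
  imports Defs
begin

section \<open>Ring homomorphisms and the Nullstellensatz\<close>

text \<open>The ideal (f, g) need not be radical: a function vanishing on the union is only known to
  have a power in it. Separating functions are therefore replaced throughout by high powers, which
  leaves their zero sets unchanged. What makes two equations impossible is the locus x_i = x_j = 0:
  since \<alpha>, \<beta> > 0, all surfaces collapse there to the origin, so f and g restricted to
  the (y_1, y_2)-plane have the origin as their only common zero, and their only syzygies are the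
  trivial ones. Condition (B)(i) makes \<alpha> and \<beta> integers. Coprimality of both a_k and
  b_k with d makes y_1 separate the surfaces off x_j = 0 and y_2 separate them off x_i = 0.
  Condition (C) keeps the surfaces in the slice indexed by a single root z.\<close>

definition ring_hom :: "('r::comm_ring_1 \<Rightarrow> 's::comm_ring_1) \<Rightarrow> bool" where
  "ring_hom \<phi> \<longleftrightarrow> \<phi> 1 = 1 \<and> (\<forall>x y. \<phi> (x + y) = \<phi> x + \<phi> y) \<and> (\<forall>x y. \<phi> (x * y) = \<phi> x * \<phi> y)"

lemma ring_hom_1: "ring_hom \<phi> \<Longrightarrow> \<phi> 1 = 1"
  and ring_hom_add: "ring_hom \<phi> \<Longrightarrow> \<phi> (x + y) = \<phi> x + \<phi> y"
  and ring_hom_mult: "ring_hom \<phi> \<Longrightarrow> \<phi> (x * y) = \<phi> x * \<phi> y"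
  by (auto simp: ring_hom_def)

lemma ring_hom_0: "ring_hom \<phi> \<Longrightarrow> \<phi> 0 = 0"
  using ring_hom_add[of \<phi> 0 0] by simp

lemma ring_hom_diff: "ring_hom \<phi> \<Longrightarrow> \<phi> (x - y) = \<phi> x - \<phi> y"
  using ring_hom_add[of \<phi> "x - y" y] by simp

lemma ring_hom_power: "ring_hom \<phi> \<Longrightarrow> \<phi> (x ^ n) = \<phi> x ^ n"
  by (induction n) (auto simp: ring_hom_1 ring_hom_mult)

lemma ring_hom_prod: "ring_hom \<phi> \<Longrightarrow> \<phi> (\<Prod>x\<in>A. f x) = (\<Prod>x\<in>A. \<phi> (f x))"
  by (induction A rule: infinite_finite_induct) (auto simp: ring_hom_1 ring_hom_mult)

lemma ring_hom_sum: "ring_hom \<phi> \<Longrightarrow> \<phi> (\<Sum>x\<in>A. f x) = (\<Sum>x\<in>A. \<phi> (f x))"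
  by (induction A rule: infinite_finite_induct) (auto simp: ring_hom_0 ring_hom_add)

lemmas ring_hom_simps = ring_hom_0 ring_hom_1 ring_hom_add ring_hom_diff ring_hom_mult
  ring_hom_power ring_hom_prod ring_hom_sum

definition eval_at :: "('r::comm_ring_1 \<Rightarrow> 's::comm_ring_1) \<Rightarrow> 's \<Rightarrow> 'r poly \<Rightarrow> 's" where
  "eval_at \<phi> x p = poly (map_poly \<phi> p) x"

lemma eval_at_0: "eval_at \<phi> x 0 = 0"
  by (simp add: eval_at_def)

lemma eval_at_pCons:
  "ring_hom \<phi> \<Longrightarrow> eval_at \<phi> x (pCons a p) = \<phi> a + x * eval_at \<phi> x p"
  by (simp add: eval_at_def map_poly_pCons ring_hom_0)

lemma ring_hom_eval_at:
  assumes "ring_hom \<phi>"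
  shows "ring_hom (eval_at \<phi> x)"
proof -
  have add: "eval_at \<phi> x (p + q) = eval_at \<phi> x p + eval_at \<phi> x q" for p q
  proof (induction p arbitrary: q)
    case (pCons a p)
    then show ?case
      by (cases q) (simp add: eval_at_pCons assms ring_hom_add algebra_simps)
  qed (simp add: eval_at_0)
  have smult: "eval_at \<phi> x (smult c p) = \<phi> c * eval_at \<phi> x p" for c p
    by (induction p) (simp_all add: eval_at_0 eval_at_pCons assms ring_hom_mult algebra_simps)
  have "eval_at \<phi> x (p * q) = eval_at \<phi> x p * eval_at \<phi> x q" for p q
    by (induction p)
      (simp_all add: eval_at_0 eval_at_pCons assms add smult ring_hom_0 algebra_simps)
  moreover have "eval_at \<phi> x 1 = 1"
    by (simp add: one_pCons eval_at_pCons assms eval_at_0 ring_hom_1)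
  ultimately show ?thesis
    using add by (simp add: ring_hom_def)
qed

section \<open>Ideals and prime ideals of commutative rings\<close>

definition ideal :: "'r::comm_ring_1 set \<Rightarrow> bool" where
  "ideal I \<longleftrightarrow> 0 \<in> I \<and> (\<forall>x\<in>I. \<forall>y\<in>I. x + y \<in> I) \<and> (\<forall>r. \<forall>x\<in>I. r * x \<in> I)"

lemma ideal_0: "ideal I \<Longrightarrow> 0 \<in> I"
  and ideal_add: "ideal I \<Longrightarrow> x \<in> I \<Longrightarrow> y \<in> I \<Longrightarrow> x + y \<in> I"
  and ideal_mult: "ideal I \<Longrightarrow> x \<in> I \<Longrightarrow> r * x \<in> I"
  by (auto simp: ideal_def)

lemma ideal_mult': "ideal I \<Longrightarrow> x \<in> I \<Longrightarrow> x * r \<in> I"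
  using ideal_mult[of I x r] by (simp add: mult.commute)

lemma ideal_uminus: "ideal I \<Longrightarrow> x \<in> I \<Longrightarrow> - x \<in> I"
  using ideal_mult[of I x "- 1"] by simp

lemma ideal_diff: "ideal I \<Longrightarrow> x \<in> I \<Longrightarrow> y \<in> I \<Longrightarrow> x - y \<in> I"
  using ideal_add[of I x "- y"] ideal_uminus[of I y] by simp

lemma ideal_diff_iff: "ideal I \<Longrightarrow> x - y \<in> I \<Longrightarrow> x \<in> I \<longleftrightarrow> y \<in> I"
  using ideal_add[of I "x - y" y] ideal_diff[of I x "x - y"] by auto

lemma ideal_sum: "ideal I \<Longrightarrow> (\<And>x. x \<in> A \<Longrightarrow> f x \<in> I) \<Longrightarrow> (\<Sum>x\<in>A. f x) \<in> I"
  by (induction A rule: infinite_finite_induct) (auto simp: ideal_0 ideal_add)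

lemma ideal_adjoin:
  assumes "ideal I"
  shows "ideal {y + r * x | y r. y \<in> I}" (is "ideal ?J")
  unfolding ideal_def
proof (intro conjI ballI allI)
  show "0 \<in> ?J"
    using ideal_0[OF assms] by (auto intro!: exI[of _ 0])
next
  fix u v assume "u \<in> ?J" "v \<in> ?J"
  then obtain y r z s where "u = y + r * x" "y \<in> I" "v = z + s * x" "z \<in> I" by auto
  moreover have "y + r * x + (z + s * x) = (y + z) + (r + s) * x" by (simp add: algebra_simps)
  ultimately show "u + v \<in> ?J"
    using ideal_add[OF assms] by blast
next
  fix c u assume "u \<in> ?J"
  then obtain y r where "u = y + r * x" "y \<in> I" by auto
  moreover have "c * (y + r * x) = c * y + (c * r) * x" by (simp add: algebra_simps)
  ultimately show "c * u \<in> ?J"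
    using ideal_mult[OF assms] by blast
qed

lemma ideal_principal: "ideal {r * (x::'r::comm_ring_1) | r. True}"
  using ideal_adjoin[of "{0}" x] by (simp add: ideal_def)

lemma ideal_two: "ideal {u * f + v * (g::'r::comm_ring_1) | u v. True}"
proof -
  have "{y + r * g | y r. y \<in> {u * f | u. True}} = {u * f + v * g | u v. True}" by auto
  then show ?thesis
    using ideal_adjoin[OF ideal_principal[of f], of g] by simp
qed

definition prime_ideal :: "'r::comm_ring_1 set \<Rightarrow> bool" where
  "prime_ideal P \<longleftrightarrow> ideal P \<and> 1 \<notin> P \<and> (\<forall>x y. x * y \<in> P \<longrightarrow> x \<in> P \<or> y \<in> P)"

lemma prime_ideal_imp_ideal: "prime_ideal P \<Longrightarrow> ideal P"
  by (simp add: prime_ideal_def)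

lemma prime_ideal_multD: "prime_ideal P \<Longrightarrow> x * y \<in> P \<Longrightarrow> x \<in> P \<or> y \<in> P"
  by (simp add: prime_ideal_def)

lemma prime_ideal_power: "prime_ideal P \<Longrightarrow> x \<notin> P \<Longrightarrow> x ^ n \<notin> P"
  by (induction n) (auto simp: prime_ideal_def)

text \<open>An ideal maximal among those that contain \<open>I\<close> and no power of
  \<open>a\<close> is prime: if \<open>x\<close> and \<open>y\<close> lie outside it, adjoining
  either one captures a power of \<open>a\<close>, and the product of these two powers lies in the
  ideal plus the multiples of \<open>x * y\<close>.\<close>

lemma prime_ideal_avoiding_powers:
  assumes I: "ideal I" and a: "\<And>n. a ^ n \<notin> I"
  obtains P where "prime_ideal P" "I \<subseteq> P" "a \<notin> P"
proof -
  define \<A> where "\<A> = {J. ideal J \<and> I \<subseteq> J \<and> (\<forall>n. a ^ n \<notin> J)}"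
  have "\<exists>M\<in>\<A>. \<forall>X\<in>\<A>. M \<subseteq> X \<longrightarrow> X = M"
  proof (rule subset_Zorn_nonempty)
    show "\<A> \<noteq> {}" using I a by (auto simp: \<A>_def)
  next
    fix \<C> assume ne: "\<C> \<noteq> {}" and ch: "subset.chain \<A> \<C>"
    have mem: "J \<in> \<C> \<Longrightarrow> J \<in> \<A>" for J using ch by (auto simp: subset.chain_def)
    have "ideal (\<Union>\<C>)"
      unfolding ideal_def
    proof (intro conjI ballI allI)
      show "0 \<in> \<Union>\<C>" using ne mem by (force simp: \<A>_def ideal_0)
    next
      fix x y assume "x \<in> \<Union>\<C>" "y \<in> \<Union>\<C>"
      then obtain J K where JK: "x \<in> J" "J \<in> \<C>" "y \<in> K" "K \<in> \<C>" by auto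
      then have "J \<subseteq> K \<or> K \<subseteq> J" using ch by (auto simp: subset.chain_def)
      moreover have "ideal J" "ideal K" using JK mem by (auto simp: \<A>_def)
      ultimately show "x + y \<in> \<Union>\<C>"
        using JK by (meson UnionI ideal_add subsetD)
    next
      fix r x assume "x \<in> \<Union>\<C>"
      then show "r * x \<in> \<Union>\<C>" using mem by (auto simp: \<A>_def intro: ideal_mult)
    qed
    then show "\<Union>\<C> \<in> \<A>" using ne mem by (fastforce simp: \<A>_def)
  qed
  then obtain M where M: "ideal M" "I \<subseteq> M" "\<And>n. a ^ n \<notin> M"
    and max: "\<And>X. ideal X \<Longrightarrow> I \<subseteq> X \<Longrightarrow> (\<And>n. a ^ n \<notin> X) \<Longrightarrow> M \<subseteq> X \<Longrightarrow> X = M"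
    by (auto simp: \<A>_def)
  have adj: "\<exists>n m r. m \<in> M \<and> a ^ n = m + r * x" if "x \<notin> M" for x
  proof (rule ccontr)
    let ?J = "{y + r * x | y r. y \<in> M}"
    assume "\<not> ?thesis"
    then have "\<And>n. a ^ n \<notin> ?J" by auto
    moreover have "M \<subseteq> ?J"
    proof
      fix y assume "y \<in> M"
      moreover have "y = y + 0 * x" by simp
      ultimately show "y \<in> ?J" by blast
    qed
    ultimately have "?J = M" using max[OF ideal_adjoin[OF M(1)]] M(2) by blast
    moreover have "x = 0 + 1 * x" by simp
    then have "x \<in> ?J" using ideal_0[OF M(1)] by blast
    ultimately show False using that by blast
  qed
  have "x \<in> M \<or> y \<in> M" if xy: "x * y \<in> M" for x y
  proof (rule ccontr)
    assume "\<not> ?thesis"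
    then obtain k l m m' r r' where *: "m \<in> M" "a ^ k = m + r * x" "m' \<in> M" "a ^ l = m' + r' * y"
      using adj by meson
    have "a ^ (k + l) = m * (m' + r' * y) + r * x * m' + r * r' * (x * y)"
      by (simp add: power_add * algebra_simps)
    moreover have "\<dots> \<in> M" 
      by (intro ideal_add[OF M(1)] ideal_mult'[OF M(1) *(1)] ideal_mult[OF M(1) *(3)]
            ideal_mult[OF M(1) xy])
    ultimately show False using M(3) by metis
  qed
  then have "prime_ideal M" using M(1) M(3)[of 0] by (auto simp: prime_ideal_def)
  then show thesis using M(2) M(3)[of 1] that by auto
qed

text \<open>\<open>H\<close> stands for a set of points, each encoded as its evaluation
  homomorphism. Leaving the ring abstract, instead of fixing a number of variables, is what allows
  one variable to be adjoined over arbitrary coefficients and the step to be iterated.\<close>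

definition nullstellensatz :: "('r::comm_ring_1 \<Rightarrow> 'k::field) set \<Rightarrow> bool" where
  "nullstellensatz H \<longleftrightarrow> (\<forall>\<phi>\<in>H. ring_hom \<phi>) \<and>
     (\<forall>I a. ideal I \<and> (\<forall>n. a ^ n \<notin> I) \<longrightarrow> (\<exists>\<phi>\<in>H. (\<forall>x\<in>I. \<phi> x = 0) \<and> \<phi> a \<noteq> 0))"

lemma nullstellensatz_field: "nullstellensatz {\<lambda>x::'k::field. x}"
proof -
  have "(\<forall>x\<in>I. x = 0) \<and> a \<noteq> 0" if I: "ideal I" and a: "\<forall>n. a ^ n \<notin> I" for I and a :: 'k
  proof -
    have "x = 0" if "x \<in> I" for x
    proof (rule ccontr)
      assume "x \<noteq> 0"
      then have "a ^ 0 = (1 / x) * x" by simp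
      then show False using a that ideal_mult[OF I, of x "1 / x"] by metis
    qed
    moreover have "a \<noteq> 0"
      using a[rule_format, of 1] ideal_0[OF I] by auto
    ultimately show ?thesis by blast
  qed
  then have "\<forall>I a. ideal I \<and> (\<forall>n. a ^ n \<notin> I) \<longrightarrow> (\<forall>x\<in>I. x = 0) \<and> a \<noteq> (0::'k)"
    by blast
  then show ?thesis by (simp add: nullstellensatz_def ring_hom_def)
qed

text \<open>The quotient by \<open>p\<close> is never formed, so a polynomial that is nonzero modulo
  \<open>p\<close> can have leading terms with coefficients in \<open>p\<close>. Cutting these off
  gives a representative whose degree is the true degree modulo \<open>p\<close>.\<close>

lemma strip_coeffs:
  fixes f :: "'r::comm_ring_1 poly"
  assumes p: "ideal p" and f: "\<exists>i. coeff f i \<notin> p"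
  obtains f' where "lead_coeff f' \<notin> p" "\<And>i. coeff (f - f') i \<in> p"
proof -
  define m where "m = (GREATEST i. coeff f i \<notin> p)"
  have le: "i \<le> degree f" if "coeff f i \<notin> p" for i
    using that ideal_0[OF p] by (intro le_degree) auto
  have m: "coeff f m \<notin> p"
    unfolding m_def using f le by (rule GreatestI_ex_nat)
  have gr: "coeff f i \<in> p" if "i > m" for i
  proof (rule ccontr)
    assume "coeff f i \<notin> p"
    then have "i \<le> m" unfolding m_def using le by (rule Greatest_le_nat)
    then show False using that by simp
  qed
  define f' where "f' = poly_cutoff (Suc m) f"
  have c: "coeff f' i = (if i \<le> m then coeff f i else 0)" for i
    by (auto simp: f'_def coeff_poly_cutoff)
  have "coeff f m \<noteq> 0" using m ideal_0[OF p] by auto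
  then have "degree f' = m"
    by (intro antisym degree_le le_degree) (auto simp: c)
  then show thesis
    using m gr p by (intro that[of f']) (auto simp: c ideal_0)
qed

text \<open>Division by a polynomial \<open>g\<close> in \<open>(R/p)[X]\<close>, up to a power of the leading coefficient.\<close>

lemma pseudo_division_ideal:
  fixes g :: "'r::comm_ring_1 poly"
  assumes Q: "ideal Q" and p: "ideal p" and g: "g \<in> Q" "lead_coeff g \<notin> p"
    and min: "\<forall>f\<in>Q. lead_coeff f \<notin> p \<longrightarrow> degree g \<le> degree f"
    and pQ: "\<forall>f. (\<forall>i. coeff f i \<in> p) \<longrightarrow> f \<in> Q"
    and f: "f \<in> Q"
  shows "\<exists>k s. \<forall>i. coeff (smult (lead_coeff g ^ k) f - s * g) i \<in> p"
proof -
  define c where "c = lead_coeff g"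
  have "\<exists>k s. \<forall>i. coeff (smult (c ^ k) f - s * g) i \<in> p"
    if "f \<in> Q" "\<And>i. i \<ge> n \<Longrightarrow> coeff f i = 0" for n f
    using that
  proof (induction n arbitrary: f)
    case 0
    then have "f = 0" by (intro poly_eqI) auto
    then show ?case by (intro exI[of _ 0]) (auto simp: ideal_0[OF p])
  next
    case (Suc n)
    define e where "e = coeff f n"
    show ?case
    proof (cases "e \<in> p")
      case True
      have me: "coeff (monom e n) i \<in> p" for i
        using True ideal_0[OF p] by simp
      have "f - monom e n \<in> Q"
        using me pQ by (intro ideal_diff[OF Q Suc.prems(1)]) blast
      moreover have "coeff (f - monom e n) i = 0" if "i \<ge> n" for i
        using that Suc.prems(2)[of i] by (cases "i = n") (simp_all add: e_def)
      ultimately obtain k s where ks: "\<And>i. coeff (smult (c ^ k) (f - monom e n) - s * g) i \<in> p"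
        using Suc.IH by blast
      have "coeff (smult (c ^ k) f - s * g) i \<in> p" for i
      proof -
        have "coeff (smult (c ^ k) f - s * g) i =
            coeff (smult (c ^ k) (f - monom e n) - s * g) i + c ^ k * coeff (monom e n) i"
          by (simp add: algebra_simps)
        then show ?thesis
          using ks[of i] me[of i] by (simp only: ideal_add[OF p] ideal_mult[OF p])
      qed
      then show ?thesis by blast
    next
      case False
      then have "e \<noteq> 0" using ideal_0[OF p] by auto
      then have deg: "degree f = n"
        using Suc.prems(2) unfolding e_def
        by (intro antisym degree_le le_degree) auto
      then have gn: "degree g \<le> n" using min[rule_format, OF Suc.prems(1)] False deg by (simp add: e_def)
      define f' where "f' = smult c f - monom e (n - degree g) * g"
      have "f' \<in> Q"
        unfolding f'_def using ideal_mult[OF Q Suc.prems(1), of "[:c:]"] g(1)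
        by (intro ideal_diff[OF Q] ideal_mult[OF Q]) auto
      moreover have "coeff f' i = 0" if "i \<ge> n" for i
      proof (cases "i = n")
        case True
        then show ?thesis using gn by (simp add: f'_def coeff_monom_mult e_def c_def)
      next
        case False
        then have "coeff f i = 0" using Suc.prems(2) that by simp
        moreover have "coeff g (i - (n - degree g)) = 0"
          using False that gn by (intro coeff_eq_0) auto
        ultimately show ?thesis by (auto simp: f'_def coeff_monom_mult)
      qed
      ultimately obtain k s where ks: "\<And>i. coeff (smult (c ^ k) f' - s * g) i \<in> p"
        using Suc.IH[of f'] by auto
      have "smult (c ^ k) f' - s * g =
          smult (c ^ Suc k) f - (s + smult (c ^ k) (monom e (n - degree g))) * g"
        by (simp add: f'_def algebra_simps smult_diff_right)
      then have "coeff (smult (c ^ Suc k) f - (s + smult (c ^ k) (monom e (n - degree g))) * g) i \<in> p"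
        for i
        using ks[of i] by simp
      then show ?thesis by blast
    qed
  qed
  moreover have "coeff f i = 0" if "i \<ge> Suc (degree f)" for i
    using that by (intro coeff_eq_0) simp
  ultimately show ?thesis
    using f unfolding c_def by blast
qed

lemma poly_in_ideal_if_coeffs:
  assumes Q: "ideal Q" and coeffs: "\<And>i. [:coeff f i:] \<in> Q"
  shows "f \<in> Q"
proof -
  have "(\<Sum>i\<le>degree f. monom 1 i * [:coeff f i:]) \<in> Q"
    by (intro ideal_sum[OF Q] ideal_mult[OF Q] coeffs)
  also have "(\<Sum>i\<le>degree f. monom 1 i * [:coeff f i:]) = (\<Sum>i\<le>degree f. monom (coeff f i) i)"
    by (intro sum.cong refl) (simp add: mult.commute[of "monom 1 _"] smult_monom)
  also have "\<dots> = f" by (rule poly_as_sum_of_monoms)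
  finally show ?thesis .
qed

lemma coeff_mult_in_ideal:
  assumes "ideal p" "\<And>i. coeff f i \<in> p"
  shows "coeff (f * g) i \<in> p"
  unfolding coeff_mult by (intro ideal_sum ideal_mult' assms)

text \<open>Over a finite field, one plus the product of all \<open>X - a\<close> would take only
  the value one and hence have no root.\<close>

lemma infinite_alg_closed: "infinite (UNIV :: 'k::alg_closed_field set)"
proof
  assume fin: "finite (UNIV :: 'k set)"
  define q where "q = (\<Prod>a::'k\<in>UNIV. [:- a, 1:])"
  have "q \<noteq> 0" using fin by (auto simp: q_def)
  have root: "poly q x = 0" for x using fin by (auto simp: q_def poly_prod)
  have "degree (q + 1) = 0"
  proof (rule ccontr)
    assume "degree (q + 1) \<noteq> 0"
    then obtain x where "poly (q + 1) x = 0" using alg_closed_imp_poly_has_root by blast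
    then show False using root[of x] by simp
  qed
  then obtain c where c: "q + 1 = [:c:]" by (auto elim: degree_eq_zeroE)
  then have "q = [:c:] - 1" by (simp add: eq_diff_eq)
  then have "q = [:c - 1:]" by (simp add: one_pCons)
  moreover have "poly q 0 = 0" by (rule root)
  ultimately show False using \<open>q \<noteq> 0\<close> by simp
qed

lemma poly_nonroot_exists:
  fixes q :: "'k::alg_closed_field poly"
  assumes "q \<noteq> 0"
  obtains x where "poly q x \<noteq> 0"
  using poly_roots_finite[OF assms] infinite_alg_closed[where 'k = 'k]
  by (metis (mono_tags, lifting) UNIV_eq_I mem_Collect_eq)

lemma eval_at_kills:
  assumes "ring_hom \<phi>" "\<forall>r\<in>p. \<phi> r = 0" "\<And>i. coeff f i \<in> p"
  shows "eval_at \<phi> x f = 0"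
proof -
  have "map_poly \<phi> f = 0"
    using assms by (intro poly_eqI) (simp add: coeff_map_poly ring_hom_0)
  then show ?thesis by (simp add: eval_at_def)
qed

lemma nullstellensatz_primeD:
  assumes "nullstellensatz H" "prime_ideal p" "r \<notin> p"
  obtains \<phi> where "\<phi> \<in> H" "ring_hom \<phi>" "\<forall>x\<in>p. \<phi> x = 0" "\<phi> r \<noteq> 0"
  using assms prime_ideal_power[OF assms(2,3)] prime_ideal_imp_ideal[OF assms(2)]
  unfolding nullstellensatz_def by meson

text \<open>After enlarging \<open>I\<close> to a prime \<open>P\<close> avoiding \<open>a\<close>,
  let \<open>p\<close> be the contraction of \<open>P\<close> to the coefficients. A point of
  \<open>H\<close> killing \<open>p\<close> is extended by a value of the variable: almost arbitrary
  if the variable is transcendental modulo \<open>P\<close>, and a root of a minimal polynomial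
  otherwise. The hypothesis on \<open>H\<close> is used to keep finitely many coefficients nonzero
  at the point.\<close>

lemma nullstellensatz_poly:
  fixes H :: "('r::comm_ring_1 \<Rightarrow> 'k::alg_closed_field) set"
  assumes H: "nullstellensatz H"
  shows "nullstellensatz {eval_at \<phi> x | \<phi> x. \<phi> \<in> H}"
proof -
  have "\<exists>\<phi>\<in>H. \<exists>x. (\<forall>f\<in>I. eval_at \<phi> x f = 0) \<and> eval_at \<phi> x a \<noteq> 0"
    if I: "ideal I" and aI: "\<forall>n. a ^ n \<notin> I" for I and a :: "'r poly"
  proof -
    obtain P where P: "prime_ideal P" and IP: "I \<subseteq> P" and aP: "a \<notin> P"
      using prime_ideal_avoiding_powers[OF I] aI by metis
    have idP: "ideal P" using P by (rule prime_ideal_imp_ideal)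
    define p where "p = {r. [:r:] \<in> P}"
    have "ideal p"
      unfolding ideal_def
    proof (intro conjI ballI allI)
      show "0 \<in> p" using ideal_0[OF idP] by (simp add: p_def)
    next
      fix x y assume "x \<in> p" "y \<in> p"
      then show "x + y \<in> p" using ideal_add[OF idP, of "[:x:]" "[:y:]"] by (simp add: p_def)
    next
      fix r x assume "x \<in> p"
      then show "r * x \<in> p" using ideal_mult[OF idP, of "[:x:]" "[:r:]"]
        by (simp add: p_def mult.commute)
    qed
    moreover have "x \<in> p \<or> y \<in> p" if "x * y \<in> p" for x y
      using that prime_ideal_multD[OF P, of "[:x:]" "[:y:]"]
      by (simp add: p_def mult.commute)
    moreover have "1 \<notin> p" using P by (simp add: p_def prime_ideal_def flip: one_pCons)
    ultimately have p: "prime_ideal p" unfolding prime_ideal_def by blast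
    then have idp: "ideal p" by (rule prime_ideal_imp_ideal)
    have pP: "f \<in> P" if "\<And>i. coeff f i \<in> p" for f
    proof (rule poly_in_ideal_if_coeffs[OF idP])
      show "[:coeff f i:] \<in> P" for i using that by (simp add: p_def)
    qed
    have "\<exists>\<phi>\<in>H. \<exists>x. (\<forall>f\<in>P. eval_at \<phi> x f = 0) \<and> eval_at \<phi> x a \<noteq> 0"
    proof (cases "\<exists>g\<in>P. lead_coeff g \<notin> p")
      \<comment> \<open>The transcendental case: \<open>P\<close> consists of the polynomials with
        all coefficients in \<open>p\<close>, so any nonroot of the image of \<open>a\<close> will
        do.\<close>
      case False
      have Pp: "coeff f i \<in> p" if f: "f \<in> P" for f i
      proof (rule ccontr)
        assume "coeff f i \<notin> p"
        then obtain f' where f': "lead_coeff f' \<notin> p" "\<And>i. coeff (f - f') i \<in> p"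
          using strip_coeffs[OF idp, of f] by blast
        have "f' \<in> P" using pP[OF f'(2)] f ideal_diff_iff[OF idP, of f f'] by simp
        then show False using f'(1) False by blast
      qed
      obtain i where "coeff a i \<notin> p" using aP pP by blast
      then obtain \<phi> where \<phi>: "\<phi> \<in> H" "ring_hom \<phi>" "\<forall>r\<in>p. \<phi> r = 0" "\<phi> (coeff a i) \<noteq> 0"
        using nullstellensatz_primeD[OF H p] by metis
      have "coeff (map_poly \<phi> a) i \<noteq> 0"
        using \<phi> by (simp add: coeff_map_poly ring_hom_0)
      then have "map_poly \<phi> a \<noteq> 0" by auto
      then obtain x where "eval_at \<phi> x a \<noteq> 0"
        unfolding eval_at_def by (rule poly_nonroot_exists)
      moreover have "\<forall>f\<in>P. eval_at \<phi> x f = 0"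
        using Pp eval_at_kills[OF \<phi>(2,3)] by blast
      ultimately show ?thesis using \<phi>(1) by blast
    next
      case True
      \<comment> \<open>The algebraic case: \<open>g\<close> acts as a minimal polynomial of the
        variable over the fraction field of the quotient by \<open>p\<close>. Adjoining
        \<open>a\<close> to \<open>P\<close> will be shown to produce a constant outside
        \<open>p\<close>.\<close>
      then obtain g where g: "g \<in> P" "lead_coeff g \<notin> p"
        and gmin: "\<forall>f\<in>P. lead_coeff f \<notin> p \<longrightarrow> degree g \<le> degree f"
        using ex_has_least_nat[of "\<lambda>g. g \<in> P \<and> lead_coeff g \<notin> p" _ degree] by blast
      define c where "c = lead_coeff g"
      have "degree g \<noteq> 0"
      proof
        assume "degree g = 0"
        then obtain x where "g = [:x:]" by (rule degree_eq_zeroE)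
        then show False using g by (simp add: p_def)
      qed
      define Q where "Q = {y + r * a | y r. y \<in> P}"
      have idQ: "ideal Q" unfolding Q_def using idP by (rule ideal_adjoin)
      have PQ: "P \<subseteq> Q"
      proof
        fix y assume "y \<in> P"
        moreover have "y = y + 0 * a" by simp
        ultimately show "y \<in> Q" unfolding Q_def by blast
      qed
      have "a = 0 + 1 * a" by simp
      then have aQ: "a \<in> Q" using ideal_0[OF idP] unfolding Q_def by blast
      have pP': "\<forall>f. (\<forall>i. coeff f i \<in> p) \<longrightarrow> f \<in> P"
        by (simp add: pP)
      then have pQ: "\<forall>f. (\<forall>i. coeff f i \<in> p) \<longrightarrow> f \<in> Q"
        using PQ by auto
      have gQ: "g \<in> Q" using g(1) PQ by blast
      obtain f where f: "f \<in> Q" "lead_coeff f \<notin> p"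
        and fmin: "\<forall>h\<in>Q. lead_coeff h \<notin> p \<longrightarrow> degree f \<le> degree h"
        using ex_has_least_nat[of "\<lambda>g. g \<in> Q \<and> lead_coeff g \<notin> p" g degree] g(2) gQ by blast
      define e where "e = lead_coeff f"
      note div_f = pseudo_division_ideal[OF idQ idp f fmin pQ, folded e_def]
      obtain k s where ks: "\<And>i. coeff (smult (e ^ k) a - s * f) i \<in> p"
        using div_f[OF aQ] by blast
      obtain l t where lt: "\<And>i. coeff (smult (e ^ l) g - t * f) i \<in> p"
        using div_f[OF gQ] by blast
      have ep: "e ^ m \<notin> p" for m
        using prime_ideal_power[OF p] f(2) by (simp add: e_def)
      have smultP: "h \<in> P" if "smult (e ^ m) h \<in> P" for m h
        using that prime_ideal_multD[OF P, of "[:e ^ m:]" h] ep[of m] by (simp add: p_def)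
      have "f \<notin> P"
      proof
        assume "f \<in> P"
        then have "smult (e ^ k) a \<in> P"
          using ideal_diff_iff[OF idP pP[OF ks]] ideal_mult[OF idP] by blast
        then show False using smultP aP by blast
      qed
      moreover have "smult (e ^ l) g \<in> P"
        using ideal_mult[OF idP g(1), of "[:e ^ l:]"] by simp
      then have "t * f \<in> P" using ideal_diff_iff[OF idP pP[OF lt]] by blast
      ultimately have tP: "t \<in> P" using prime_ideal_multD[OF P] by blast
      \<comment> \<open>Irreducibility of \<open>g\<close> in disguise. Modulo \<open>p\<close>,
        \<open>e ^ l\<close> times \<open>g\<close> equals \<open>t * f\<close> with
        \<open>t\<close> in \<open>P\<close>. If \<open>t\<close> is nonzero modulo
        \<open>p\<close>, its degree there is at least that of \<open>g\<close>, so a nonconstant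
        \<open>f\<close> makes the product too large; if \<open>t\<close> is zero modulo
        \<open>p\<close>, then \<open>e ^ l * lead_coeff g\<close> lies in \<open>p\<close>.\<close>
      have "degree f = 0"
      proof (rule ccontr)
        assume deg: "degree f \<noteq> 0"
        have "coeff t i \<in> p" for i
        proof (rule ccontr)
          assume "coeff t i \<notin> p"
          then obtain t' where t': "lead_coeff t' \<notin> p" "\<And>i. coeff (t - t') i \<in> p"
            using strip_coeffs[OF idp, of t] by blast
          have "t' \<in> P" using pP[OF t'(2)] tP ideal_diff_iff[OF idP, of t t'] by simp
          then have "degree g \<le> degree t'" using gmin t'(1) by blast
          define m where "m = degree t' + degree f"
          have "coeff g m = 0"
            using deg \<open>degree g \<le> degree t'\<close> by (intro coeff_eq_0) (simp add: m_def)
          then have "- coeff (t * f) m \<in> p" using lt[of m] by simp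
          then have "coeff (t * f) m \<in> p" using ideal_uminus[OF idp] by fastforce
          moreover have "coeff ((t - t') * f) m \<in> p"
            using coeff_mult_in_ideal[OF idp t'(2)] .
          ultimately have "coeff (t' * f) m \<in> p"
            using ideal_diff[OF idp, of "coeff (t * f) m" "coeff ((t - t') * f) m"]
            by (simp add: algebra_simps)
          then have "lead_coeff t' * lead_coeff f \<in> p"
            unfolding m_def by (simp add: coeff_mult_degree_sum)
          then show False using prime_ideal_multD[OF p] t'(1) f(2) by blast
        qed
        then have "coeff (t * f) (degree g) \<in> p" by (rule coeff_mult_in_ideal[OF idp])
        then have "e ^ l * lead_coeff g \<in> p"
          using lt[of "degree g"] ideal_add[OF idp] by fastforce
        then show False using prime_ideal_multD[OF p] g(2) ep by blast
      qed
      then obtain x where "f = [:x:]" by (rule degree_eq_zeroE)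
      then have "f = [:e:]" by (simp add: e_def)
      with f(1) obtain y r where yr: "[:e:] = y + r * a" "y \<in> P"
        unfolding Q_def by auto
      \<comment> \<open>Keeping \<open>c\<close> nonzero preserves the degree of \<open>g\<close>,
        which gives a root, and lets powers of \<open>c\<close> be cancelled after pseudo-division.
        Keeping \<open>e\<close> nonzero forces \<open>a\<close> to be nonzero at that root, since
        \<open>e\<close> is a multiple of \<open>a\<close> modulo \<open>P\<close>.\<close>
      have "c * e \<notin> p" using prime_ideal_multD[OF p] g(2) f(2) by (auto simp: c_def e_def)
      then obtain \<phi> where \<phi>: "\<phi> \<in> H" "ring_hom \<phi>" "\<forall>r\<in>p. \<phi> r = 0" "\<phi> (c * e) \<noteq> 0"
        using nullstellensatz_primeD[OF H p] by metis
      then have ce: "\<phi> c \<noteq> 0" "\<phi> e \<noteq> 0" by (auto simp: ring_hom_mult)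
      have "coeff (map_poly \<phi> g) (degree g) \<noteq> 0"
        using ce(1) \<phi>(2) by (simp add: coeff_map_poly ring_hom_0 c_def)
      then have "degree (map_poly \<phi> g) > 0" using \<open>degree g \<noteq> 0\<close> le_degree by fastforce
      then obtain x where x: "eval_at \<phi> x g = 0"
        using alg_closed_imp_poly_has_root unfolding eval_at_def by blast
      note hom = ring_hom_eval_at[OF \<phi>(2), of x]
      have const: "eval_at \<phi> x [:r:] = \<phi> r" for r
        by (simp add: eval_at_pCons \<phi>(2) eval_at_0)
      have kill: "eval_at \<phi> x h = 0" if h: "h \<in> P" for h
      proof -
        obtain k s where ks: "\<And>i. coeff (smult (c ^ k) h - s * g) i \<in> p"
          using pseudo_division_ideal[OF idP idp g gmin pP' h] unfolding c_def by blast
        have "smult (c ^ k) h - s * g = [:c ^ k:] * h - s * g" by simp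
        then have "eval_at \<phi> x ([:c ^ k:] * h - s * g) = 0"
          using eval_at_kills[OF \<phi>(2,3) ks] by simp
        then have "\<phi> c ^ k * eval_at \<phi> x h = 0"
          by (simp only: ring_hom_diff[OF hom] ring_hom_mult[OF hom] x const
                ring_hom_power[OF \<phi>(2)]) simp
        then show ?thesis using ce(1) by simp
      qed
      have "\<phi> e = eval_at \<phi> x r * eval_at \<phi> x a"
        using arg_cong[OF yr(1), of "eval_at \<phi> x"] kill[OF yr(2)]
        by (simp add: ring_hom_add[OF hom] ring_hom_mult[OF hom] const)
      then have "eval_at \<phi> x a \<noteq> 0" using ce(2) by auto
      then show ?thesis using kill \<phi>(1) by blast
    qed
    then show ?thesis using IP by blast
  qed
  moreover have "\<forall>\<phi>\<in>H. ring_hom \<phi>" using H by (simp add: nullstellensatz_def)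
  ultimately show ?thesis
    unfolding nullstellensatz_def by (auto intro: ring_hom_eval_at) blast
qed

lemma nullstellensatz_two:
  assumes "nullstellensatz H"
    and "\<And>\<phi>. \<phi> \<in> H \<Longrightarrow> ring_hom \<phi> \<Longrightarrow> \<phi> f = 0 \<Longrightarrow> \<phi> g = 0 \<Longrightarrow> \<phi> a = 0"
  shows "\<exists>n u v. a ^ n = u * f + v * g"
proof (rule ccontr)
  assume contr: "\<not> ?thesis"
  let ?I = "{u * f + v * g | u v. True}"
  have "\<forall>n. a ^ n \<notin> ?I" using contr by blast
  then obtain \<phi> where \<phi>: "\<phi> \<in> H" "\<forall>x\<in>?I. \<phi> x = 0" "\<phi> a \<noteq> 0"
    using assms(1) ideal_two[of f g] unfolding nullstellensatz_def by meson
  have "f = 1 * f + 0 * g" "g = 0 * f + 1 * g" by simp_all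
  then have "f \<in> ?I" "g \<in> ?I" by blast+
  then have "\<phi> f = 0" "\<phi> g = 0" using \<phi>(2) by auto
  moreover have "ring_hom \<phi>" using assms(1) \<phi>(1) by (simp add: nullstellensatz_def)
  ultimately show False using assms(2) \<phi>(1,3) by blast
qed

section \<open>Koszul relations\<close>

text \<open>Vanishing of the first Koszul homology of \<open>f\<close>, \<open>g\<close> modulo
  \<open>I\<close>: every syzygy is a multiple of the trivial one \<open>(g, -f)\<close>. Unlike
  regularity of a sequence, this does not depend on the order of \<open>f\<close> and
  \<open>g\<close>.\<close>

definition koszul_exact :: "'r::comm_ring_1 set \<Rightarrow> 'r \<Rightarrow> 'r \<Rightarrow> bool" where
  "koszul_exact I f g \<longleftrightarrow>
     (\<forall>u v. u * f + v * g \<in> I \<longrightarrow> (\<exists>w. u - w * g \<in> I \<and> v + w * f \<in> I))"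

text \<open>The ideal generated by \<open>f\<close> and \<open>g\<close> contains a regular sequence
  \<open>p\<close>, \<open>q\<close>, so it has depth at least two. Concretely, for a syzygy
  \<open>(u, v)\<close> the factor \<open>u / g\<close> equals both
  \<open>(b * u - a * v) / p\<close> and \<open>(b' * u - a' * v) / q\<close>, and comparing the two
  fractions shows that \<open>p\<close> divides the first numerator.\<close>

lemma koszul_exact_idom:
  fixes f g p q :: "'r::idom"
  assumes p: "p = a * f + b * g" and q: "q = a' * f + b' * g" and "p \<noteq> 0"
    and pq: "\<And>s. p dvd q * s \<Longrightarrow> p dvd s"
  shows "koszul_exact {0} f g"
proof -
  have aux: "\<exists>w. u = w * g \<and> v = - (w * f)"
    if rel: "u * f + v * g = 0" and p: "p = a * f + b * g" and q: "q = a' * f + b' * g" and "g \<noteq> 0"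
    for u v f g a b a' b'
  proof -
    have uf: "u * f = - (v * g)" using rel by (simp add: add_eq_0_iff2)
    have pu: "p * u = g * (b * u - a * v)"
    proof -
      have "p * u = a * (u * f) + b * g * u" by (simp add: p algebra_simps)
      also have "\<dots> = g * (b * u - a * v)" unfolding uf by (simp add: algebra_simps)
      finally show ?thesis .
    qed
    have qu: "q * u = g * (b' * u - a' * v)"
    proof -
      have "q * u = a' * (u * f) + b' * g * u" by (simp add: q algebra_simps)
      also have "\<dots> = g * (b' * u - a' * v)" unfolding uf by (simp add: algebra_simps)
      finally show ?thesis .
    qed
    have "g * (q * (b * u - a * v)) = q * (p * u)" by (simp add: pu algebra_simps)
    also have "\<dots> = p * (q * u)" by (simp add: algebra_simps)
    also have "\<dots> = g * (p * (b' * u - a' * v))" by (simp add: qu algebra_simps)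
    finally have "q * (b * u - a * v) = p * (b' * u - a' * v)" using \<open>g \<noteq> 0\<close> by simp
    then have "p dvd b * u - a * v" using pq by (metis dvd_triv_left)
    then obtain w where w: "b * u - a * v = p * w" by (elim dvdE)
    then have "p * u = p * (w * g)" using pu by (simp add: algebra_simps)
    then have u: "u = w * g" using \<open>p \<noteq> 0\<close> by simp
    have "v * g = - (w * f) * g" using uf u by (simp add: algebra_simps)
    then show ?thesis using u \<open>g \<noteq> 0\<close> by (metis mult_right_cancel)
  qed
  have "\<exists>w. u - w * g = 0 \<and> v + w * f = 0" if rel: "u * f + v * g = 0" for u v
  proof (cases "g = 0")
    case False
    then show ?thesis using aux[OF rel p q] by auto
  next
    case True
    then have "f \<noteq> 0" using p \<open>p \<noteq> 0\<close> by auto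
    moreover have "v * g + u * f = 0" "p = b * g + a * f" "q = b' * g + a' * f"
      using rel p q by (simp_all add: add.commute)
    ultimately obtain w where "v = w * f" "u = - (w * g)" using aux by metis
    then show ?thesis by (intro exI[of _ "- w"]) simp
  qed
  then show ?thesis by (simp add: koszul_exact_def)
qed

text \<open>Modulo \<open>I\<close> and the \<open>k\<close>-th power of the variable, the factor
  \<open>w\<close> is built one degree at a time. Once the lower coefficients of the corrected
  syzygy lie in \<open>I\<close>, its next coefficients form a syzygy of the constant terms of
  \<open>f\<close> and \<open>g\<close> alone, and \<open>base\<close> supplies the next term of
  \<open>w\<close>.\<close>

lemma koszul_exact_poly:
  fixes f g :: "'r::comm_ring_1 poly"
  assumes I: "ideal I" and base: "koszul_exact I (coeff f 0) (coeff g 0)"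
  shows "koszul_exact {p. \<forall>i<k. coeff p i \<in> I} f g"
proof -
  have "\<exists>w. \<forall>i<k. coeff (u - w * g) i \<in> I \<and> coeff (v + w * f) i \<in> I"
    if "\<forall>i<k. coeff (u * f + v * g) i \<in> I" for u v
    using that
  proof (induction k)
    case (Suc k)
    then obtain w where w: "\<And>i. i < k \<Longrightarrow> coeff (u - w * g) i \<in> I"
        "\<And>i. i < k \<Longrightarrow> coeff (v + w * f) i \<in> I"
      by auto
    define u' v' where "u' = u - w * g" and "v' = v + w * f"
    have low: "coeff (p * h) k - coeff p k * coeff h 0 \<in> I" if "\<And>i. i < k \<Longrightarrow> coeff p i \<in> I" for p h
    proof -
      have "coeff (p * h) k = (\<Sum>i<k. coeff p i * coeff h (k - i)) + coeff p k * coeff h 0"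
        by (simp add: coeff_mult lessThan_Suc_atMost [symmetric])
      then show ?thesis using that by (auto intro!: ideal_sum[OF I] ideal_mult'[OF I])
    qed
    have "u' * f + v' * g = u * f + v * g" by (simp add: u'_def v'_def algebra_simps)
    then have "coeff (u' * f) k + coeff (v' * g) k \<in> I" using Suc.prems by (metis coeff_add lessI)
    moreover have "coeff (u' * f) k - coeff u' k * coeff f 0 \<in> I"
      "coeff (v' * g) k - coeff v' k * coeff g 0 \<in> I"
      by (rule low; simp only: u'_def v'_def w)+
    ultimately have "(coeff (u' * f) k + coeff (v' * g) k)
        - (coeff (u' * f) k - coeff u' k * coeff f 0)
        - (coeff (v' * g) k - coeff v' k * coeff g 0) \<in> I"
      by (rule ideal_diff[OF I ideal_diff[OF I]])
    then have "coeff u' k * coeff f 0 + coeff v' k * coeff g 0 \<in> I" by (simp add: algebra_simps)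
    then obtain c where c: "coeff u' k - c * coeff g 0 \<in> I" "coeff v' k + c * coeff f 0 \<in> I"
      using base unfolding koszul_exact_def by blast
    have "coeff (u - (w + monom c k) * g) i \<in> I \<and> coeff (v + (w + monom c k) * f) i \<in> I"
      if "i < Suc k" for i
    proof -
      have eq: "u - (w + monom c k) * g = u' - monom c k * g"
          "v + (w + monom c k) * f = v' + monom c k * f"
        by (simp_all add: u'_def v'_def algebra_simps)
      show ?thesis
      proof (cases "i = k")
        case True
        then show ?thesis unfolding eq using c by (simp add: coeff_monom_mult)
      next
        case False
        then have "i < k" using that by simp
        then show ?thesis
          unfolding eq using w[of i] by (simp add: coeff_monom_mult u'_def v'_def)
      qed
    qed
    then show ?case by blast
  qed simp
  then have "\<exists>w. (\<forall>i<k. coeff (u - w * g) i \<in> I) \<and> (\<forall>i<k. coeff (v + w * f) i \<in> I)"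
    if "\<forall>i<k. coeff (u * f + v * g) i \<in> I" for u v
    using that by blast
  then show ?thesis unfolding koszul_exact_def mem_Collect_eq by blast
qed

lemma const_dvd_monom_mult:
  fixes s :: "'r::idom poly"
  assumes "[:c:] dvd monom 1 k * s"
  shows "[:c:] dvd s"
proof -
  have "c dvd coeff s n" for n
    using assms[unfolded const_poly_dvd_iff, rule_format, of "n + k"] by (simp add: coeff_monom_mult)
  then show ?thesis by (simp add: const_poly_dvd_iff)
qed

lemma split_const_monom:
  fixes p :: "'r::idom poly"
  assumes "\<And>i. i < k \<Longrightarrow> c dvd coeff p i"
  shows "\<exists>r s. p = [:c:] * r + monom 1 k * s"
proof -
  have "[:c:] dvd poly_cutoff k p"
    using assms by (simp add: const_poly_dvd_iff coeff_poly_cutoff)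
  moreover have "monom 1 k dvd p - poly_cutoff k p"
    by (simp add: monom_1_dvd_iff' coeff_poly_cutoff)
  ultimately obtain r s where "poly_cutoff k p = [:c:] * r" "p - poly_cutoff k p = monom 1 k * s"
    by (meson dvdE)
  then show ?thesis by (metis add_diff_cancel_left' diff_add_cancel add.commute)
qed

text \<open>
  Vanishing of the first Koszul homology of \<open>X\<^sup>k, Z\<^sup>k\<close> on \<open>S[X][Z]/(f, g)\<close>: by symmetry of the Koszul
  complex it is inherited from that of \<open>f, g\<close> modulo \<open>(X\<^sup>k, Z\<^sup>k)\<close>.
\<close>

lemma glue_sections:
  fixes f g :: "'s::idom poly poly"
  assumes base: "koszul_exact {0} (coeff (coeff f 0) 0) (coeff (coeff g 0) 0)"
    and rel: "monom 1 k * e\<^sub>1 - [:monom 1 k:] * e\<^sub>2 = u * f + v * g"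
  shows "\<exists>e s t. e\<^sub>1 = [:monom 1 k:] * e + s * f + t * g"
proof -
  define c :: "'s poly" where "c = monom 1 k"
  define J where "J = {p::'s poly. \<forall>i<k. coeff p i \<in> {0}}"
  have J: "p \<in> J \<longleftrightarrow> c dvd p" for p
    by (simp add: J_def c_def monom_1_dvd_iff')
  then have idJ: "ideal J" by (auto simp: ideal_def)
  have "koszul_exact J (coeff f 0) (coeff g 0)"
    unfolding J_def by (rule koszul_exact_poly[OF _ base]) (simp add: ideal_def)
  then have "koszul_exact {p. \<forall>i<k. coeff p i \<in> J} f g" by (rule koszul_exact_poly[OF idJ])
  moreover have "u * f + v * g \<in> {p. \<forall>i<k. coeff p i \<in> J}"
    unfolding rel[symmetric] J by (auto simp: coeff_monom_mult c_def)
  ultimately obtain w where w: "\<And>i. i < k \<Longrightarrow> c dvd coeff (u - w * g) i"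
      "\<And>i. i < k \<Longrightarrow> c dvd coeff (v + w * f) i"
    unfolding koszul_exact_def mem_Collect_eq J by meson
  obtain r s r' s' where rs: "u - w * g = [:c:] * r + monom 1 k * s"
      "v + w * f = [:c:] * r' + monom 1 k * s'"
    using split_const_monom[of k c "u - w * g", OF w(1)]
      split_const_monom[of k c "v + w * f", OF w(2)] by blast
  \<comment> \<open>Correcting \<open>(u, v)\<close> by the trivial syzygy does not change
    \<open>u * f + v * g\<close>, but moves both coefficients into the ideal generated by the two
    powers. Sorting terms then puts one power on each side, and these are coprime.\<close>
  have shuffle: "m * (x - (s * f + s' * g)) = c * (y + (r * f + r' * g))"
    if "u - w * g = c * r + m * s" "v + w * f = c * r' + m * s'" "m * x - c * y = u * f + v * g"
    for m x y c :: "'s poly poly"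
  proof -
    have "m * x - c * y = (u - w * g) * f + (v + w * f) * g"
      unfolding that(3) by (simp add: algebra_simps)
    then show ?thesis unfolding that(1,2) by (simp add: algebra_simps)
  qed
  have "monom 1 k * (e\<^sub>1 - (s * f + s' * g)) = [:c:] * (e\<^sub>2 + (r * f + r' * g))"
    by (rule shuffle[OF rs rel[folded c_def]])
  then have "[:c:] dvd e\<^sub>1 - (s * f + s' * g)"
    by (metis const_dvd_monom_mult dvd_triv_left)
  then obtain e where "e\<^sub>1 - (s * f + s' * g) = [:c:] * e" by (elim dvdE)
  then have "e\<^sub>1 = [:c:] * e + s * f + s' * g" by (simp only: diff_eq_eq add.assoc)
  then show ?thesis unfolding c_def by blast
qed

section \<open>Surfaces meeting at a point\<close>

text \<open>The nesting order, \<open>y\<^sub>1\<close> innermost and \<open>x\<^sub>2\<close>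
  outermost, is chosen so that taking constant coefficients twice restricts to the plane where
  \<open>x\<^sub>1\<close> and \<open>x\<^sub>2\<close> vanish.\<close>

definition ev :: "'k \<Rightarrow> 'k \<Rightarrow> 'k \<Rightarrow> 'k \<Rightarrow> 'k::field poly poly poly poly \<Rightarrow> 'k" where
  "ev y\<^sub>1 y\<^sub>2 x\<^sub>1 x\<^sub>2 = eval_at (eval_at (eval_at (eval_at (\<lambda>c. c) y\<^sub>1) y\<^sub>2) x\<^sub>1) x\<^sub>2"

lemma ring_hom_ident: "ring_hom (\<lambda>c. c)"
  by (simp add: ring_hom_def)

lemma ring_hom_ev: "ring_hom (ev y\<^sub>1 y\<^sub>2 x\<^sub>1 x\<^sub>2)"
  unfolding ev_def by (intro ring_hom_eval_at ring_hom_ident)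

lemma ev_at_origin:
  "ev y\<^sub>1 y\<^sub>2 0 0 f = eval_at (eval_at (\<lambda>c. c) y\<^sub>1) y\<^sub>2 (coeff (coeff f 0) 0)"
proof -
  have "eval_at \<phi> 0 p = \<phi> (coeff p 0)" if "ring_hom \<phi>"
    for \<phi> :: "'r::comm_ring_1 \<Rightarrow> 's::comm_ring_1" and p
    by (cases p) (simp add: eval_at_pCons that)
  then show ?thesis unfolding ev_def by (simp add: eval_at_def poly_0_coeff_0 coeff_map_poly)
qed

abbreviation coeff_const :: "'k::field \<Rightarrow> 'k poly poly poly poly" where
  "coeff_const c \<equiv> [:[:[:[:c:]:]:]:]"
abbreviation var_y\<^sub>1 :: "'k::field poly poly poly poly" where
  "var_y\<^sub>1 \<equiv> [:[:[:[:0, 1:]:]:]:]"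
abbreviation var_y\<^sub>2 :: "'k::field poly poly poly poly" where
  "var_y\<^sub>2 \<equiv> [:[:[:0, 1:]:]:]"
abbreviation var_x\<^sub>1 :: "'k::field poly poly poly poly" where
  "var_x\<^sub>1 \<equiv> [:[:0, 1:]:]"
abbreviation var_x\<^sub>2 :: "'k::field poly poly poly poly" where
  "var_x\<^sub>2 \<equiv> [:0, 1:]"

lemma ev_simps:
  "ev y\<^sub>1 y\<^sub>2 x\<^sub>1 x\<^sub>2 (coeff_const c) = c"
  "ev y\<^sub>1 y\<^sub>2 x\<^sub>1 x\<^sub>2 var_y\<^sub>1 = y\<^sub>1"
  "ev y\<^sub>1 y\<^sub>2 x\<^sub>1 x\<^sub>2 var_y\<^sub>2 = y\<^sub>2"
  "ev y\<^sub>1 y\<^sub>2 x\<^sub>1 x\<^sub>2 var_x\<^sub>1 = x\<^sub>1"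
  "ev y\<^sub>1 y\<^sub>2 x\<^sub>1 x\<^sub>2 var_x\<^sub>2 = x\<^sub>2"
  unfolding ev_def
  by (simp_all add: eval_at_pCons eval_at_0 ring_hom_eval_at ring_hom_ident ring_hom_0 ring_hom_1)

lemmas ev_hom_simps = ring_hom_simps[OF ring_hom_ev] ev_simps

lemma nullstellensatz_ev:
  fixes f g a :: "'k::alg_closed_field poly poly poly poly"
  assumes "\<And>y\<^sub>1 y\<^sub>2 x\<^sub>1 x\<^sub>2. ev y\<^sub>1 y\<^sub>2 x\<^sub>1 x\<^sub>2 f = 0 \<Longrightarrow> ev y\<^sub>1 y\<^sub>2 x\<^sub>1 x\<^sub>2 g = 0 \<Longrightarrow> ev y\<^sub>1 y\<^sub>2 x\<^sub>1 x\<^sub>2 a = 0"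
  shows "\<exists>n u v. a ^ n = u * f + v * g"
proof (rule nullstellensatz_two)
  show "nullstellensatz {eval_at \<phi> x\<^sub>2 | \<phi> x\<^sub>2. \<phi> \<in> {eval_at \<phi> x\<^sub>1 | \<phi> x\<^sub>1. \<phi> \<in>
    {eval_at \<phi> y\<^sub>2 | \<phi> y\<^sub>2. \<phi> \<in> {eval_at \<phi> y\<^sub>1 | \<phi> y\<^sub>1. \<phi> \<in> {\<lambda>c::'k. c}}}}}"
    by (intro nullstellensatz_poly nullstellensatz_field)
qed (use assms in \<open>auto simp: ev_def\<close>)

lemma nullstellensatz_eval_two:
  fixes f g a :: "'k::alg_closed_field poly poly"
  assumes "\<And>y\<^sub>1 y\<^sub>2. eval_at (eval_at (\<lambda>c. c) y\<^sub>1) y\<^sub>2 f = 0 \<Longrightarrow>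
    eval_at (eval_at (\<lambda>c. c) y\<^sub>1) y\<^sub>2 g = 0 \<Longrightarrow> eval_at (eval_at (\<lambda>c. c) y\<^sub>1) y\<^sub>2 a = 0"
  shows "\<exists>n u v. a ^ n = u * f + v * g"
proof (rule nullstellensatz_two)
  show "nullstellensatz {eval_at \<phi> y\<^sub>2 | \<phi> y\<^sub>2. \<phi> \<in> {eval_at \<phi> y\<^sub>1 | \<phi> y\<^sub>1. \<phi> \<in> {\<lambda>c::'k. c}}}"
    by (intro nullstellensatz_poly nullstellensatz_field)
qed (use assms in auto)

lemma eval_at_vars:
  "eval_at (eval_at (\<lambda>c::'k::field. c) y\<^sub>1) y\<^sub>2 [:[:0, 1:]:] = y\<^sub>1"
  "eval_at (eval_at (\<lambda>c::'k::field. c) y\<^sub>1) y\<^sub>2 [:0, 1:] = y\<^sub>2"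
  by (simp_all add: eval_at_pCons eval_at_0 ring_hom_eval_at ring_hom_ident ring_hom_0 ring_hom_1)

lemma eval_at_along_curve:
  assumes hom: "\<And>t. ring_hom (\<phi> t)" and "\<And>p. \<exists>r. \<forall>t::'k::comm_ring_1. \<phi> t p = poly r t"
  shows "\<exists>r. \<forall>t. eval_at (\<phi> t) (poly c t) p = poly r t"
proof (induction p)
  case 0
  show ?case by (intro exI[of _ 0]) (simp add: eval_at_0)
next
  case (pCons a p)
  obtain r s where "\<forall>t. \<phi> t a = poly r t" "\<forall>t. eval_at (\<phi> t) (poly c t) p = poly s t"
    using assms(2) pCons by metis
  then show ?case by (intro exI[of _ "r + c * s"]) (simp add: eval_at_pCons hom)
qed

lemma ev_along_curve:
  "\<exists>r. \<forall>t. ev (poly c\<^sub>1 t) (poly c\<^sub>2 t) (poly c\<^sub>3 t) (poly c\<^sub>4 t) p = poly r t"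
  unfolding ev_def
  by (intro eval_at_along_curve ring_hom_eval_at ring_hom_ident) (metis poly_const_conv)

text \<open>Continuity made algebraic: along the curve, \<open>e\<close> is a polynomial in
  \<open>t\<close>; being constant at infinitely many \<open>t\<close>, it keeps that value at
  \<open>t = 0\<close>, where the curve meets the origin because \<open>\<beta>\<close> is
  positive.\<close>

lemma ev_eq_at_origin:
  fixes e :: "'k::alg_closed_field poly poly poly poly"
  assumes "\<beta> > 0" and "\<And>t. t \<noteq> 0 \<Longrightarrow> ev 0 (c * t ^ \<beta>) t 0 e = b"
  shows "ev 0 0 0 0 e = b"
proof -
  obtain r where r: "\<And>t. ev (poly 0 t) (poly (monom c \<beta>) t) (poly [:0, 1:] t) (poly 0 t) e = poly r t"
    using ev_along_curve by metis
  have "r - [:b:] = 0"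
  proof (rule ccontr)
    assume "r - [:b:] \<noteq> 0"
    then have "finite {t. poly (r - [:b:]) t = 0}" by (rule poly_roots_finite)
    moreover have "UNIV - {0} \<subseteq> {t. poly (r - [:b:]) t = 0}"
      using assms(2) r by (auto simp: poly_monom)
    ultimately show False
      using infinite_alg_closed[where 'k = 'k] finite_subset by (metis finite_Diff2 finite.emptyI finite_insert)
  qed
  then have "poly r 0 = b" by simp
  then show ?thesis using r[of 0] \<open>\<beta> > 0\<close> by (simp add: poly_monom zero_power)
qed

text \<open>
  A case of Hartshorne's connectedness theorem: the surfaces
  \<open>S\<^sub>z = {y\<^sub>1 = \<sigma> z x\<^sub>2\<^sup>\<alpha>, y\<^sub>2 = \<tau> z x\<^sub>1\<^sup>\<beta>}\<close> meet only at the origin. The function equal to \<open>1\<close> on \<open>S\<^sub>z\<^sub>0\<close> and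
  to \<open>0\<close> on the other surfaces is \<open>e\<^sub>1 / x\<^sub>1\<^sup>k\<close> on \<open>x\<^sub>1 \<noteq> 0\<close> and \<open>e\<^sub>2 / x\<^sub>2\<^sup>k\<close> on \<open>x\<^sub>2 \<noteq> 0\<close>; it would extend to a
  polynomial, which cannot be both \<open>1\<close> and \<open>0\<close> at the origin.
\<close>

lemma surfaces_meeting_at_point_not_two_equations:
  fixes f g :: "'k::alg_closed_field poly poly poly poly"
  assumes zeros: "\<And>y\<^sub>1 y\<^sub>2 x\<^sub>1 x\<^sub>2. ev y\<^sub>1 y\<^sub>2 x\<^sub>1 x\<^sub>2 f = 0 \<and> ev y\<^sub>1 y\<^sub>2 x\<^sub>1 x\<^sub>2 g = 0 \<longleftrightarrow>
      (\<exists>z\<in>M. y\<^sub>1 = \<sigma> z * x\<^sub>2 ^ \<alpha> \<and> y\<^sub>2 = \<tau> z * x\<^sub>1 ^ \<beta>)"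
    and M: "finite M" "z\<^sub>0 \<in> M" "z\<^sub>1 \<in> M" "z\<^sub>0 \<noteq> z\<^sub>1"
    and inj: "inj_on \<sigma> M" "inj_on \<tau> M"
    and pos: "\<alpha> > 0" "\<beta> > 0"
  shows False
proof -
  define h\<^sub>1 where "h\<^sub>1 = var_y\<^sub>2 - coeff_const (\<tau> z\<^sub>0) * var_x\<^sub>1 ^ \<beta>"
  define q\<^sub>1 where "q\<^sub>1 = (\<Prod>z\<in>M - {z\<^sub>0}. var_y\<^sub>2 - coeff_const (\<tau> z) * var_x\<^sub>1 ^ \<beta>)"
  define h\<^sub>2 where "h\<^sub>2 = var_y\<^sub>1 - coeff_const (\<sigma> z\<^sub>0) * var_x\<^sub>2 ^ \<alpha>"
  define q\<^sub>2 where "q\<^sub>2 = (\<Prod>z\<in>M - {z\<^sub>0}. var_y\<^sub>1 - coeff_const (\<sigma> z) * var_x\<^sub>2 ^ \<alpha>)"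
  have ev_h\<^sub>1: "ev y\<^sub>1 y\<^sub>2 x\<^sub>1 x\<^sub>2 h\<^sub>1 = y\<^sub>2 - \<tau> z\<^sub>0 * x\<^sub>1 ^ \<beta>"
    and ev_q\<^sub>1: "ev y\<^sub>1 y\<^sub>2 x\<^sub>1 x\<^sub>2 q\<^sub>1 = (\<Prod>z\<in>M - {z\<^sub>0}. y\<^sub>2 - \<tau> z * x\<^sub>1 ^ \<beta>)"
    and ev_h\<^sub>2: "ev y\<^sub>1 y\<^sub>2 x\<^sub>1 x\<^sub>2 h\<^sub>2 = y\<^sub>1 - \<sigma> z\<^sub>0 * x\<^sub>2 ^ \<alpha>"
    and ev_q\<^sub>2: "ev y\<^sub>1 y\<^sub>2 x\<^sub>1 x\<^sub>2 q\<^sub>2 = (\<Prod>z\<in>M - {z\<^sub>0}. y\<^sub>1 - \<sigma> z * x\<^sub>2 ^ \<alpha>)"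
    for y\<^sub>1 y\<^sub>2 x\<^sub>1 x\<^sub>2
    by (simp_all only: h\<^sub>1_def h\<^sub>2_def q\<^sub>1_def q\<^sub>2_def ev_hom_simps)
  \<comment> \<open>The mixed product vanishes on every surface: \<open>h\<^sub>1\<close> on the one
    of \<open>z\<^sub>0\<close>, and \<open>q\<^sub>2\<close> on all others. The same holds for
    \<open>h\<^sub>2 * q\<^sub>1\<close> below.\<close>
  have "\<exists>n u v. (h\<^sub>1 * q\<^sub>2) ^ n = u * f + v * g"
    by (rule nullstellensatz_ev)
      (use zeros M(1) in \<open>fastforce simp: ring_hom_mult[OF ring_hom_ev] ev_h\<^sub>1 ev_q\<^sub>2\<close>)
  moreover have "\<exists>n u v. (h\<^sub>2 * q\<^sub>1) ^ n = u * f + v * g"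
    by (rule nullstellensatz_ev)
      (use zeros M(1) in \<open>fastforce simp: ring_hom_mult[OF ring_hom_ev] ev_h\<^sub>2 ev_q\<^sub>1\<close>)
  ultimately obtain n\<^sub>1 u\<^sub>1 v\<^sub>1 n\<^sub>2 u\<^sub>2 v\<^sub>2 where
    "(h\<^sub>1 * q\<^sub>2) ^ n\<^sub>1 = u\<^sub>1 * f + v\<^sub>1 * g" "(h\<^sub>2 * q\<^sub>1) ^ n\<^sub>2 = u\<^sub>2 * f + v\<^sub>2 * g"
    by blast
  \<comment> \<open>A common exponent for both relations; the successor makes it positive, so that
    \<open>N\<close>-th powers have the same zeros as their bases.\<close>
  define N where "N = Suc (n\<^sub>1 + n\<^sub>2)"
  have N: "N = (N - n\<^sub>1) + n\<^sub>1" "N = (N - n\<^sub>2) + n\<^sub>2" by (simp_all add: N_def)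
  define u\<^sub>3 v\<^sub>3 where "u\<^sub>3 = (h\<^sub>1 * q\<^sub>2) ^ (N - n\<^sub>1) * u\<^sub>1" and "v\<^sub>3 = (h\<^sub>1 * q\<^sub>2) ^ (N - n\<^sub>1) * v\<^sub>1"
  define u\<^sub>4 v\<^sub>4 where "u\<^sub>4 = (h\<^sub>2 * q\<^sub>1) ^ (N - n\<^sub>2) * u\<^sub>2" and "v\<^sub>4 = (h\<^sub>2 * q\<^sub>1) ^ (N - n\<^sub>2) * v\<^sub>2"
  have "(h\<^sub>1 * q\<^sub>2) ^ N = (h\<^sub>1 * q\<^sub>2) ^ (N - n\<^sub>1) * (h\<^sub>1 * q\<^sub>2) ^ n\<^sub>1"
    using N(1) by (metis power_add)
  then have hq\<^sub>1: "h\<^sub>1 ^ N * q\<^sub>2 ^ N = u\<^sub>3 * f + v\<^sub>3 * g"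
    unfolding \<open>(h\<^sub>1 * q\<^sub>2) ^ n\<^sub>1 = _\<close> u\<^sub>3_def v\<^sub>3_def power_mult_distrib[of _ _ N]
    by (simp only: distrib_left mult.assoc)
  have "(h\<^sub>2 * q\<^sub>1) ^ N = (h\<^sub>2 * q\<^sub>1) ^ (N - n\<^sub>2) * (h\<^sub>2 * q\<^sub>1) ^ n\<^sub>2"
    using N(2) by (metis power_add)
  then have hq\<^sub>2: "h\<^sub>2 ^ N * q\<^sub>1 ^ N = u\<^sub>4 * f + v\<^sub>4 * g"
    unfolding \<open>(h\<^sub>2 * q\<^sub>1) ^ n\<^sub>2 = _\<close> u\<^sub>4_def v\<^sub>4_def power_mult_distrib[of _ _ N]
    by (simp only: distrib_left mult.assoc)

  have "N > 0" by (simp add: N_def)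
  \<comment> \<open>Off \<open>x\<^sub>1 = 0\<close> the coordinate \<open>y\<^sub>2\<close>
    separates the surfaces. A power of \<open>x\<^sub>1\<close> thus splits into a part vanishing on
    the surface of \<open>z\<^sub>0\<close> and a part vanishing on the others, a partition of unity
    after division.\<close>
  have "x\<^sub>1 = 0" if h: "ev y\<^sub>1 y\<^sub>2 x\<^sub>1 x\<^sub>2 h\<^sub>1 = 0" "ev y\<^sub>1 y\<^sub>2 x\<^sub>1 x\<^sub>2 q\<^sub>1 = 0" for y\<^sub>1 y\<^sub>2 x\<^sub>1 x\<^sub>2
  proof -
    obtain z where z: "z \<in> M" "z \<noteq> z\<^sub>0" "y\<^sub>2 = \<tau> z * x\<^sub>1 ^ \<beta>"
      using h(2) M(1) by (auto simp: ev_q\<^sub>1)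
    then have "(\<tau> z - \<tau> z\<^sub>0) * x\<^sub>1 ^ \<beta> = 0" using h(1) by (simp add: ev_h\<^sub>1 algebra_simps)
    moreover have "\<tau> z \<noteq> \<tau> z\<^sub>0" using z M(2) inj(2) by (auto dest: inj_onD)
    ultimately show ?thesis by simp
  qed
  then have "\<exists>n u v. var_x\<^sub>1 ^ n = u * h\<^sub>1 ^ N + v * q\<^sub>1 ^ N"
    by (intro nullstellensatz_ev) (simp add: ev_hom_simps \<open>N > 0\<close>)
  moreover have "x\<^sub>2 = 0" if h: "ev y\<^sub>1 y\<^sub>2 x\<^sub>1 x\<^sub>2 h\<^sub>2 = 0" "ev y\<^sub>1 y\<^sub>2 x\<^sub>1 x\<^sub>2 q\<^sub>2 = 0" for y\<^sub>1 y\<^sub>2 x\<^sub>1 x\<^sub>2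
  proof -
    obtain z where z: "z \<in> M" "z \<noteq> z\<^sub>0" "y\<^sub>1 = \<sigma> z * x\<^sub>2 ^ \<alpha>"
      using h(2) M(1) by (auto simp: ev_q\<^sub>2)
    then have "(\<sigma> z - \<sigma> z\<^sub>0) * x\<^sub>2 ^ \<alpha> = 0" using h(1) by (simp add: ev_h\<^sub>2 algebra_simps)
    moreover have "\<sigma> z \<noteq> \<sigma> z\<^sub>0" using z M(2) inj(1) by (auto dest: inj_onD)
    ultimately show ?thesis by simp
  qed
  then have "\<exists>n u v. var_x\<^sub>2 ^ n = u * h\<^sub>2 ^ N + v * q\<^sub>2 ^ N"
    by (intro nullstellensatz_ev) (simp add: ev_hom_simps \<open>N > 0\<close>)
  ultimately obtain m\<^sub>1 a\<^sub>1 b\<^sub>1 m\<^sub>2 a\<^sub>2 b\<^sub>2 where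
    m: "var_x\<^sub>1 ^ m\<^sub>1 = a\<^sub>1 * h\<^sub>1 ^ N + b\<^sub>1 * q\<^sub>1 ^ N" "var_x\<^sub>2 ^ m\<^sub>2 = a\<^sub>2 * h\<^sub>2 ^ N + b\<^sub>2 * q\<^sub>2 ^ N"
    by blast
  define k where "k = m\<^sub>1 + m\<^sub>2"
  define A\<^sub>1 B\<^sub>1 where "A\<^sub>1 = var_x\<^sub>1 ^ m\<^sub>2 * a\<^sub>1" and "B\<^sub>1 = var_x\<^sub>1 ^ m\<^sub>2 * b\<^sub>1"
  define A\<^sub>2 B\<^sub>2 where "A\<^sub>2 = var_x\<^sub>2 ^ m\<^sub>1 * a\<^sub>2" and "B\<^sub>2 = var_x\<^sub>2 ^ m\<^sub>1 * b\<^sub>2"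
  have "var_x\<^sub>1 ^ k = var_x\<^sub>1 ^ m\<^sub>2 * var_x\<^sub>1 ^ m\<^sub>1" by (simp only: k_def power_add mult.commute)
  also have "\<dots> = A\<^sub>1 * h\<^sub>1 ^ N + B\<^sub>1 * q\<^sub>1 ^ N"
    by (subst m(1)) (simp only: A\<^sub>1_def B\<^sub>1_def distrib_left mult.assoc)
  finally have x\<^sub>1k: "var_x\<^sub>1 ^ k = A\<^sub>1 * h\<^sub>1 ^ N + B\<^sub>1 * q\<^sub>1 ^ N" .
  have "var_x\<^sub>2 ^ k = var_x\<^sub>2 ^ m\<^sub>1 * var_x\<^sub>2 ^ m\<^sub>2" by (simp only: k_def power_add)
  also have "\<dots> = A\<^sub>2 * h\<^sub>2 ^ N + B\<^sub>2 * q\<^sub>2 ^ N"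
    by (subst m(2)) (simp only: A\<^sub>2_def B\<^sub>2_def distrib_left mult.assoc)
  finally have x\<^sub>2k: "var_x\<^sub>2 ^ k = A\<^sub>2 * h\<^sub>2 ^ N + B\<^sub>2 * q\<^sub>2 ^ N" .
  define e\<^sub>1 e\<^sub>2 where "e\<^sub>1 = B\<^sub>1 * q\<^sub>1 ^ N" and "e\<^sub>2 = B\<^sub>2 * q\<^sub>2 ^ N"
  \<comment> \<open>The two local fractions agree modulo \<open>f\<close> and \<open>g\<close> on
    the overlap: after cross-multiplication the terms with
    \<open>q\<^sub>1 ^ N * q\<^sub>2 ^ N\<close> cancel, and only the mixed products remain.\<close>
  have "X\<^sub>2 * e\<^sub>1 - X\<^sub>1 * e\<^sub>2 = (A\<^sub>2 * B\<^sub>1 * u\<^sub>4 - A\<^sub>1 * B\<^sub>2 * u\<^sub>3) * f + (A\<^sub>2 * B\<^sub>1 * v\<^sub>4 - A\<^sub>1 * B\<^sub>2 * v\<^sub>3) * g"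
    if "X\<^sub>1 = A\<^sub>1 * h\<^sub>1 ^ N + B\<^sub>1 * q\<^sub>1 ^ N" "X\<^sub>2 = A\<^sub>2 * h\<^sub>2 ^ N + B\<^sub>2 * q\<^sub>2 ^ N" for X\<^sub>1 X\<^sub>2
  proof -
    have "X\<^sub>2 * e\<^sub>1 - X\<^sub>1 * e\<^sub>2 = A\<^sub>2 * B\<^sub>1 * (h\<^sub>2 ^ N * q\<^sub>1 ^ N) - A\<^sub>1 * B\<^sub>2 * (h\<^sub>1 ^ N * q\<^sub>2 ^ N)"
      unfolding that e\<^sub>1_def e\<^sub>2_def by (simp add: algebra_simps)
    then show ?thesis unfolding hq\<^sub>1 hq\<^sub>2 by (simp add: algebra_simps)
  qed
  note rel = this[OF x\<^sub>1k x\<^sub>2k]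
  have x\<^sub>1_monom: "(var_x\<^sub>1 :: 'k poly poly poly poly) ^ k = [:monom 1 k:]" for k
    by (simp add: poly_const_pow monom_altdef)
  have x\<^sub>2_monom: "(var_x\<^sub>2 :: 'k poly poly poly poly) ^ k = monom 1 k" for k
    by (simp add: monom_altdef)

  \<comment> \<open>On the plane \<open>x\<^sub>1 = x\<^sub>2 = 0\<close> only the origin survives,
    so the restricted equations generate powers of both \<open>y\<^sub>1\<close> and
    \<open>y\<^sub>2\<close>. These powers are the regular sequence that gives the base case of
    Koszul exactness.\<close>
  define f\<^sub>0 g\<^sub>0 where "f\<^sub>0 = coeff (coeff f 0) 0" and "g\<^sub>0 = coeff (coeff g 0) 0"
  have f\<^sub>0g\<^sub>0: "y\<^sub>1 = 0 \<and> y\<^sub>2 = 0"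
    if "eval_at (eval_at (\<lambda>c. c) y\<^sub>1) y\<^sub>2 f\<^sub>0 = 0" "eval_at (eval_at (\<lambda>c. c) y\<^sub>1) y\<^sub>2 g\<^sub>0 = 0" for y\<^sub>1 y\<^sub>2
    using that zeros[of y\<^sub>1 y\<^sub>2 0 0] pos by (auto simp: ev_at_origin f\<^sub>0_def g\<^sub>0_def)
  have "\<exists>n u v. [:[:0, 1:]:] ^ n = u * f\<^sub>0 + v * g\<^sub>0"
    by (rule nullstellensatz_eval_two) (use f\<^sub>0g\<^sub>0 in \<open>unfold eval_at_vars, blast\<close>)
  then obtain l\<^sub>1 a b where l\<^sub>1: "[:[:0, 1:]:] ^ l\<^sub>1 = a * f\<^sub>0 + b * g\<^sub>0" by blast
  have "\<exists>n u v. [:0, 1:] ^ n = u * f\<^sub>0 + v * g\<^sub>0"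
    by (rule nullstellensatz_eval_two) (use f\<^sub>0g\<^sub>0 in \<open>unfold eval_at_vars, blast\<close>)
  then obtain l\<^sub>2 a' b' where l\<^sub>2: "[:0, 1:] ^ l\<^sub>2 = a' * f\<^sub>0 + b' * g\<^sub>0" by blast
  have "koszul_exact {0} f\<^sub>0 g\<^sub>0"
  proof (rule koszul_exact_idom[OF l\<^sub>1 l\<^sub>2])
    show "[:[:0, 1:]:] ^ l\<^sub>1 \<noteq> (0 :: 'k poly poly)" by simp
    show "[:[:0, 1:]:] ^ l\<^sub>1 dvd s" if "[:[:0, 1:]:] ^ l\<^sub>1 dvd [:0, 1:] ^ l\<^sub>2 * s" for s :: "'k poly poly"
      using that const_dvd_monom_mult[of "[:0, 1:] ^ l\<^sub>1" l\<^sub>2 s] by (simp add: poly_const_pow monom_altdef)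
  qed
  then obtain e s t where e: "e\<^sub>1 = [:monom 1 k:] * e + s * f + t * g"
    using glue_sections rel unfolding x\<^sub>1_monom x\<^sub>2_monom f\<^sub>0_def g\<^sub>0_def by metis

  \<comment> \<open>The part of the surface of \<open>z\<close> with \<open>x\<^sub>2 = 0\<close> is
    a curve through the origin, on which \<open>e\<close> is recovered as
    \<open>e\<^sub>1 / x ^ k\<close>. The values on the curves of \<open>z\<^sub>0\<close> and
    \<open>z\<^sub>1\<close> will conflict at the origin.\<close>
  have curve: "ev 0 (\<tau> z * x ^ \<beta>) x 0 e\<^sub>1 = x ^ k * ev 0 (\<tau> z * x ^ \<beta>) x 0 e" if "z \<in> M" for x z
  proof -
    have "ev 0 (\<tau> z * x ^ \<beta>) x 0 f = 0 \<and> ev 0 (\<tau> z * x ^ \<beta>) x 0 g = 0"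
      using zeros that pos by auto
    then show ?thesis unfolding e x\<^sub>1_monom[symmetric] by (simp add: ev_hom_simps)
  qed
  have "ev 0 (\<tau> z\<^sub>0 * x ^ \<beta>) x 0 e = 1" if "x \<noteq> 0" for x
  proof -
    have "ev 0 (\<tau> z\<^sub>0 * x ^ \<beta>) x 0 (var_x\<^sub>1 ^ k) = ev 0 (\<tau> z\<^sub>0 * x ^ \<beta>) x 0 e\<^sub>1"
      unfolding x\<^sub>1k e\<^sub>1_def by (simp add: ring_hom_simps[OF ring_hom_ev] ev_h\<^sub>1 \<open>N > 0\<close>)
    then show ?thesis using curve[OF M(2), of x] that by (simp add: ev_hom_simps)
  qed
  then have "ev 0 0 0 0 e = 1" by (rule ev_eq_at_origin[OF pos(2)])
  moreover have "ev 0 (\<tau> z\<^sub>1 * x ^ \<beta>) x 0 e = 0" if "x \<noteq> 0" for x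
  proof -
    have "ev 0 (\<tau> z\<^sub>1 * x ^ \<beta>) x 0 q\<^sub>1 = 0" using M by (auto simp: ev_q\<^sub>1)
    then have "ev 0 (\<tau> z\<^sub>1 * x ^ \<beta>) x 0 e\<^sub>1 = 0"
      unfolding e\<^sub>1_def by (simp add: ring_hom_simps[OF ring_hom_ev] \<open>N > 0\<close>)
    then show ?thesis using curve[OF M(3), of x] that by simp
  qed
  then have "ev 0 0 0 0 e = 0" by (rule ev_eq_at_origin[OF pos(2)])
  ultimately show False by simp
qed

section \<open>Slicing the toric variety\<close>

definition mpoly_subst ::
    "'k::field mpoly \<Rightarrow> (nat \<Rightarrow> 'k poly poly poly poly) \<Rightarrow> 'k poly poly poly poly" where
  "mpoly_subst f X = (\<Sum>m\<in>Poly_Mapping.keys f. coeff_const (Poly_Mapping.lookup f m) *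
     (\<Prod>i\<in>Poly_Mapping.keys m. X i ^ Poly_Mapping.lookup m i))"

lemma ev_mpoly_subst:
  "ev y\<^sub>1 y\<^sub>2 x\<^sub>1 x\<^sub>2 (mpoly_subst f X) = mpoly_eval f (\<lambda>i. ev y\<^sub>1 y\<^sub>2 x\<^sub>1 x\<^sub>2 (X i))"
  unfolding mpoly_subst_def mpoly_eval_def by (simp only: ev_hom_simps)

lemma mpoly_eval_cong:
  assumes "f \<in> mpolys N" "\<And>i. i \<in> {1..N} \<Longrightarrow> x i = y i"
  shows "mpoly_eval f x = mpoly_eval f y"
  unfolding mpoly_eval_def
proof (intro sum.cong refl arg_cong2[of _ _ _ _ "(*)"] prod.cong)
  fix m i assume "m \<in> Poly_Mapping.keys f" "i \<in> Poly_Mapping.keys m"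
  then have "i \<in> {1..N}" using assms(1) unfolding mpolys_def by blast
  then show "x i ^ Poly_Mapping.lookup m i = y i ^ Poly_Mapping.lookup m i" using assms(2) by simp
qed

text \<open>A finite infimum excludes the empty set, whose infimum is infinite, and a nonempty set
  of extended naturals attains its infimum.\<close>

lemma set_theoretic_complete_intersectionE:
  assumes "set_theoretic_complete_intersection c N V"
  obtains F where "finite F" "F \<subseteq> mpolys N" "zero_set N F = V" "card F = c"
proof -
  let ?S = "{enat (card F) | F. finite F \<and> F \<subseteq> mpolys N \<and> zero_set N F = V}"
  have Inf: "Inf ?S = enat c"
    using assms by (simp add: set_theoretic_complete_intersection_def arithmetical_rank_def)
  have "?S \<noteq> {}"
  proof
    assume "?S = {}"
    then show False using Inf by (simp only: Inf_enat_def) simp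
  qed
  then have "Inf ?S \<in> ?S" unfolding Inf_enat_def by (auto intro: LeastI)
  then show thesis unfolding Inf using that by auto
qed

section \<open>Roots of unity and their powers\<close>

lemma root_of_unity_power_cong:
  fixes z :: "'k::field"
  assumes "z ^ d = 1" "[k = l] (mod d)"
  shows "z ^ k = z ^ l"
proof -
  have "z ^ m = z ^ (m mod d)" for m
  proof -
    have "z ^ m = z ^ (d * (m div d) + m mod d)" by simp
    then show ?thesis unfolding power_add power_mult assms(1) by simp
  qed
  then show ?thesis using assms(2) by (metis cong_def)
qed

text \<open>The exponent is an inverse of \<open>m\<close> modulo \<open>d\<close>. It is the same
  for all \<open>z\<close>, which makes the \<open>m\<close>-th power map injective on the
  \<open>d\<close>-th roots of unity.\<close>

lemma root_of_unity_coprime_power: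
  fixes z :: "'k::field"
  assumes "gcd d m = 1"
  obtains x where "\<And>z::'k. z ^ d = 1 \<Longrightarrow> (z ^ m) ^ x = z"
proof -
  obtain x where x: "[m * x = 1] (mod d)"
    using cong_solve_coprime_nat[of m d] assms by (auto simp: coprime_iff_gcd_eq_1 gcd.commute)
  have "(z ^ m) ^ x = z" if "z ^ d = 1" for z :: 'k
    using root_of_unity_power_cong[OF that x] by (simp add: power_mult)
  then show thesis using that by blast
qed

lemma finite_roots_of_unity:
  assumes "d > 0"
  shows "finite {z::'k::field. z ^ d = 1}"
proof -
  have "degree (monom 1 d - 1 :: 'k poly) = d"
    using assms by (intro antisym degree_le le_degree) (auto simp: coeff_1)
  then have "finite {z. poly (monom 1 d - 1 :: 'k poly) z = 0}"
    using assms by (intro poly_roots_finite) auto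
  then show ?thesis by (simp add: poly_monom)
qed

text \<open>A root of \<open>1 + X + ... + X ^ (p - 1)\<close> works: it is a \<open>p\<close>-th
  root of unity, and it could be 1 only if \<open>p\<close> were zero in the field.\<close>

lemma nontrivial_root_of_unity_exists:
  assumes p: "prime p" and char: "CHAR('k::alg_closed_field) \<noteq> p"
  shows "\<exists>z::'k. z \<noteq> 1 \<and> z ^ p = 1"
proof -
  have p1: "p > 1" using p by (rule prime_gt_1_nat)
  then obtain z :: 'k where z: "(\<Sum>k\<le>p - 1. 1 * z ^ k) = 0"
    using alg_closed[of "p - 1" "\<lambda>_. 1"] by auto
  have "{..p - 1} = {..<p}" using p1 by auto
  then have sum0: "(\<Sum>k<p. z ^ k) = 0" using z by simp
  then have "z ^ p = 1" using one_diff_power_eq[of z p] by simp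
  moreover have "z \<noteq> 1"
  proof
    assume "z = 1"
    then have "of_nat p = (0::'k)" using sum0 by simp
    then have "CHAR('k) dvd p" by (simp add: of_nat_eq_0_iff_char_dvd)
    then have "CHAR('k) = 1" using p char by (auto simp: prime_nat_iff)
    then show False by simp
  qed
  ultimately show ?thesis by blast
qed

text \<open>The condition on \<open>c\<close> makes all \<open>(w\<^sup>a\<^sup>l, w\<^sup>b\<^sup>l)\<close> lie in the cyclic group of the \<open>(z\<^sup>a\<^sup>k, z\<^sup>b\<^sup>k)\<close>.\<close>

lemma prod_roots_of_unity_proportional:
  fixes w :: "nat \<Rightarrow> 'k::field"
  assumes w: "\<And>l. l \<in> L \<Longrightarrow> w l ^ d = 1" and "k \<in> L" and gcd: "gcd d (b k) = 1"
    and c: "\<And>l. l \<in> L \<Longrightarrow> [int (a l) = c * int (b l)] (mod int d)" and "d > 0"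
  shows "\<exists>z. z ^ d = 1 \<and> (\<Prod>l\<in>L. w l ^ a l) = z ^ a k \<and> (\<Prod>l\<in>L. w l ^ b l) = z ^ b k"
proof -
  define c' where "c' = nat (c mod int d)"
  have c': "[a l = b l * c'] (mod d)" if "l \<in> L" for l
  proof -
    have "[c * int (b l) = (c mod int d) * int (b l)] (mod int d)"
      by (intro cong_mult) (auto simp: cong_def)
    also have "(c mod int d) * int (b l) = int (b l * c')"
      using \<open>d > 0\<close> by (simp add: c'_def)
    finally have "[int (a l) = int (b l * c')] (mod int d)" using c[OF that] cong_trans by blast
    then show ?thesis by (simp only: cong_int_iff)
  qed
  \<comment> \<open>The witness will be \<open>v ^ x\<close>, with \<open>v\<close> the product for
    the exponents \<open>b\<close>: its power \<open>b k\<close> is \<open>v\<close>, and its power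
    \<open>a k\<close> is \<open>v ^ c'\<close> because \<open>a k\<close> is congruent to
    \<open>b k * c'\<close>.\<close>
  obtain x where x: "\<And>z::'k. z ^ d = 1 \<Longrightarrow> (z ^ b k) ^ x = z"
    using root_of_unity_coprime_power[OF gcd] by blast
  define v where "v = (\<Prod>l\<in>L. w l ^ b l)"
  have v: "v ^ d = 1"
  proof -
    have "v ^ d = (\<Prod>l\<in>L. (w l ^ d) ^ b l)"
      unfolding v_def prod_power_distrib by (simp add: mult.commute flip: power_mult)
    then show ?thesis by (simp add: w)
  qed
  have av: "(\<Prod>l\<in>L. w l ^ a l) = v ^ c'"
    unfolding v_def prod_power_distrib
    by (intro prod.cong refl) (metis c' root_of_unity_power_cong w power_mult)
  have vx: "(v ^ x) ^ d = 1" by (metis v power_mult mult.commute power_one)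
  have bk: "(v ^ x) ^ b k = v" by (metis x[OF v] power_mult mult.commute)
  have "(v ^ x) ^ a k = (v ^ x) ^ (b k * c')"
    by (rule root_of_unity_power_cong[OF vx c'[OF \<open>k \<in> L\<close>]])
  also have "\<dots> = v ^ c'" by (simp only: power_mult bk)
  finally show ?thesis using vx bk av unfolding v_def by metis
qed

lemma restrict_eq_iff: "restrict f A = restrict g A \<longleftrightarrow> (\<forall>x\<in>A. f x = g x)"
proof
  assume eq: "restrict f A = restrict g A"
  show "\<forall>x\<in>A. f x = g x"
  proof
    fix x assume "x \<in> A"
    then show "f x = g x" using fun_cong[OF eq, of x] by simp
  qed
qed (auto intro: restrict_ext)

text \<open>Off \<open>i\<close> and \<open>j\<close> the parameters are \<open>d\<close>-th roots
  of unity, and proportionality merges their contributions into powers of one root \<open>z\<close>.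
  The parameters at \<open>i\<close> and \<open>j\<close> enter the two products only through their
  \<open>d\<close>-th powers, which are the coordinates \<open>x\<^sub>1\<close> and
  \<open>x\<^sub>2\<close>.\<close>

lemma simplicial_toric_variety_slice:
  fixes a b :: "nat \<Rightarrow> nat" and x\<^sub>1 x\<^sub>2 y\<^sub>1 y\<^sub>2 :: "'k::alg_closed_field"
  assumes d: "d > 0" and ij: "i \<in> {1..n}" "j \<in> {1..n}" "k \<in> {1..n}" "i \<noteq> j" "k \<noteq> i" "k \<noteq> j"
    and ab: "a i = 0" "b j = 0" "a j = d * \<alpha>" "b i = d * \<beta>"
    and gcd: "gcd d (a k) = 1" "gcd d (b k) = 1"
    and C: "(\<exists>c::int. \<forall>l\<in>{1..n}. [int (a l) = c * int (b l)] (mod int d)) \<or>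
            (\<exists>c::int. \<forall>l\<in>{1..n}. [int (b l) = c * int (a l)] (mod int d))"
    and P: "\<And>l. l \<in> {1..n} - {i, j} \<Longrightarrow> P l = 1" "P i = x\<^sub>1" "P j = x\<^sub>2" "P (n + 1) = y\<^sub>1" "P (n + 2) = y\<^sub>2"
  shows "restrict P {1..n + 2} \<in> simplicial_toric_variety n d a b \<longleftrightarrow>
    (\<exists>z. z ^ d = 1 \<and> y\<^sub>1 = z ^ a k * x\<^sub>2 ^ \<alpha> \<and> y\<^sub>2 = z ^ b k * x\<^sub>1 ^ \<beta>)"
proof -
  define L where "L = {1..n} - {i, j}"
  have split: "{1..n} = insert i (insert j L)" "i \<notin> insert j L" "j \<notin> L" "finite L"
    using ij by (auto simp: L_def)
  have prod_L: "(\<Prod>l\<in>{1..n}. g l) = g i * (g j * (\<Prod>l\<in>L. g l))" for g :: "nat \<Rightarrow> 'k"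
    unfolding split(1) using split(2-4) by simp
  have kL: "k \<in> L" using ij by (simp add: L_def)
  have mem: "restrict P {1..n + 2} \<in> simplicial_toric_variety n d a b \<longleftrightarrow>
      (\<exists>u\<in>affine_space n. (\<forall>l\<in>{1..n}. P l = u l ^ d) \<and>
         y\<^sub>1 = (\<Prod>l\<in>{1..n}. u l ^ a l) \<and> y\<^sub>2 = (\<Prod>l\<in>{1..n}. u l ^ b l))" (is "_ \<longleftrightarrow> ?slice")
  proof -
    have "restrict P {1..n + 2} = (\<lambda>l\<in>{1..n + 2}. if l \<le> n then u l ^ d
          else if l = n + 1 then A else B) \<longleftrightarrow> (\<forall>l\<in>{1..n}. P l = u l ^ d) \<and> y\<^sub>1 = A \<and> y\<^sub>2 = B"
      for u A B
    proof -
      define Q where "Q = (\<lambda>l. if l \<le> n then u l ^ d else if l = n + 1 then A else B)"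
      have "{1..n + 2} = {1..n} \<union> {n + 1, n + 2}" by auto
      then have "restrict P {1..n + 2} = restrict Q {1..n + 2} \<longleftrightarrow>
          (\<forall>l\<in>{1..n}. P l = Q l) \<and> P (n + 1) = Q (n + 1) \<and> P (n + 2) = Q (n + 2)"
        unfolding restrict_eq_iff by (simp only: ball_Un) simp
      moreover have "restrict Q {1..n + 2} = (\<lambda>l\<in>{1..n + 2}. if l \<le> n then u l ^ d
          else if l = n + 1 then A else B)"
        by (simp only: Q_def)
      ultimately show ?thesis using P(4,5) by (simp add: Q_def)
    qed
    then show ?thesis unfolding simplicial_toric_variety_def image_iff by (intro bex_cong refl)
  qed
  show ?thesis
    unfolding mem
  proof
    assume ?slice
    then obtain u where u: "\<And>l. l \<in> {1..n} \<Longrightarrow> P l = u l ^ d"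
      "y\<^sub>1 = (\<Prod>l\<in>{1..n}. u l ^ a l)" "y\<^sub>2 = (\<Prod>l\<in>{1..n}. u l ^ b l)"
      by auto
    have uL: "u l ^ d = 1" if "l \<in> L" for l
      using u(1)[of l] P(1)[of l] that by (simp add: L_def)
    obtain z where z: "z ^ d = 1" "(\<Prod>l\<in>L. u l ^ a l) = z ^ a k" "(\<Prod>l\<in>L. u l ^ b l) = z ^ b k"
      using C
    proof (elim disjE exE)
      fix c assume c: "\<forall>l\<in>{1..n}. [int (a l) = c * int (b l)] (mod int d)"
      have "\<exists>z. z ^ d = 1 \<and> (\<Prod>l\<in>L. u l ^ a l) = z ^ a k \<and> (\<Prod>l\<in>L. u l ^ b l) = z ^ b k"
        by (rule prod_roots_of_unity_proportional[where c = c])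
          (use uL kL gcd(2) d c in \<open>auto simp: L_def\<close>)
      then show thesis using that by blast
    next
      fix c assume c: "\<forall>l\<in>{1..n}. [int (b l) = c * int (a l)] (mod int d)"
      have "\<exists>z. z ^ d = 1 \<and> (\<Prod>l\<in>L. u l ^ b l) = z ^ b k \<and> (\<Prod>l\<in>L. u l ^ a l) = z ^ a k"
        by (rule prod_roots_of_unity_proportional[where c = c])
          (use uL kL gcd(1) d c in \<open>auto simp: L_def\<close>)
      then show thesis using that by blast
    qed
    have "u j ^ a j = x\<^sub>2 ^ \<alpha>" "u i ^ b i = x\<^sub>1 ^ \<beta>"
      using u(1) ij(1,2) P(2,3) by (simp_all add: ab power_mult)
    then show "\<exists>z. z ^ d = 1 \<and> y\<^sub>1 = z ^ a k * x\<^sub>2 ^ \<alpha> \<and> y\<^sub>2 = z ^ b k * x\<^sub>1 ^ \<beta>"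
      using z u(2,3)[unfolded prod_L] by (intro exI[of _ z]) (simp add: ab(1,2) mult.commute)
  next
    assume "\<exists>z. z ^ d = 1 \<and> y\<^sub>1 = z ^ a k * x\<^sub>2 ^ \<alpha> \<and> y\<^sub>2 = z ^ b k * x\<^sub>1 ^ \<beta>"
    then obtain z where z: "z ^ d = 1" "y\<^sub>1 = z ^ a k * x\<^sub>2 ^ \<alpha>" "y\<^sub>2 = z ^ b k * x\<^sub>1 ^ \<beta>" by blast
    obtain r\<^sub>1 r\<^sub>2 where r: "r\<^sub>1 ^ d = x\<^sub>1" "r\<^sub>2 ^ d = x\<^sub>2"
      using nth_root_exists[OF d, of x\<^sub>1] nth_root_exists[OF d, of x\<^sub>2] by blast
    \<comment> \<open>The root \<open>z\<close> is carried by the single index \<open>k\<close>, so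
      it contributes exactly \<open>z ^ a k\<close> and \<open>z ^ b k\<close>.\<close>
    define u where "u = (\<lambda>l\<in>{1..n}. if l = i then r\<^sub>1 else if l = j then r\<^sub>2 else if l = k then z else 1)"
    have u: "u i = r\<^sub>1" "u j = r\<^sub>2" "\<And>l. l \<in> L \<Longrightarrow> u l = (if l = k then z else 1)"
      using ij by (auto simp: u_def L_def)
    have prods: "(\<Prod>l\<in>L. u l ^ e l) = z ^ e k" for e :: "nat \<Rightarrow> nat"
    proof -
      have "(\<Prod>l\<in>L. u l ^ e l) = (\<Prod>l\<in>L. if l = k then z ^ e l else 1)"
        by (intro prod.cong refl) (simp add: u(3))
      also have "\<dots> = z ^ e k" using kL by (simp add: L_def)
      finally show ?thesis .
    qed
    have "P l = u l ^ d" if "l \<in> {1..n}" for l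
      using P(1)[of l] P(2,3) r z(1) u that by (cases "l \<in> L") (auto simp: L_def)
    moreover have "y\<^sub>1 = (\<Prod>l\<in>{1..n}. u l ^ a l)" "y\<^sub>2 = (\<Prod>l\<in>{1..n}. u l ^ b l)"
      unfolding prod_L by (simp_all add: prods u(1,2) ab power_mult r z(2,3))
    moreover have "u \<in> affine_space n" by (auto simp: affine_space_def u_def)
    ultimately show ?slice by blast
  qed
qed

theorem theorem2:
  fixes n d p :: nat and a b :: "nat \<Rightarrow> nat"
    and V :: "(nat \<Rightarrow> 'a :: alg_closed_field) set"
  assumes n_pos: "n > 0"
    and d_gt_1: "d > 1"
    and nonzero: "\<forall>i\<in>{1..n}. a i \<noteq> 0 \<or> b i \<noteq> 0"
    and gcd_1: "Gcd (insert d (a ` {1..n} \<union> b ` {1..n})) = 1"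
    and V_eq: "V = simplicial_toric_variety n d a b"
    and A: "\<exists>i\<in>{1..n}. \<exists>j\<in>{1..n}. a i = 0 \<and> b i \<noteq> 0 \<and> a j \<noteq> 0 \<and> b j = 0"
    and B_i: "\<forall>i\<in>{1..n}. d dvd a i \<longleftrightarrow> d dvd b i"
    and B_ii: "\<forall>i\<in>{1..n}. (\<not> d dvd a i \<longleftrightarrow> gcd d (a i) = 1) \<and> (\<not> d dvd b i \<longleftrightarrow> gcd d (b i) = 1)"
    and C: "(\<exists>c::int. \<forall>i\<in>{1..n}. [int (a i) = c * int (b i)] (mod int d)) \<or>
            (\<exists>c::int. \<forall>i\<in>{1..n}. [int (b i) = c * int (a i)] (mod int d))"
    and D: "\<exists>i\<in>{1..n}. gcd d (a i) = 1"
    and p_prime: "prime p"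
    and p_dvd: "p dvd d"
    and char_ne: "CHAR('a) \<noteq> p"
  shows "\<not> set_theoretic_complete_intersection 2 (n + 2) V"
proof
  assume "set_theoretic_complete_intersection 2 (n + 2) V"
  then obtain F where F: "F \<subseteq> mpolys (n + 2)" "zero_set (n + 2) F = V" "card F = 2"
    by (rule set_theoretic_complete_intersectionE)
  then obtain f g where fg: "F = {f, g}" by (auto simp: card_2_iff)
  obtain i j where ij: "i \<in> {1..n}" "j \<in> {1..n}" "a i = 0" "b i \<noteq> 0" "a j \<noteq> 0" "b j = 0"
    using A by blast
  \<comment> \<open>Zero is divisible by \<open>d\<close>, so (B)(i) passes divisibility from
    \<open>a i\<close> to \<open>b i\<close> and from \<open>b j\<close> to
    \<open>a j\<close>.\<close>
  have "d dvd b i" "d dvd a j" using B_i ij(1-3,6) by force+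
  obtain \<alpha> where \<alpha>: "a j = d * \<alpha>" using \<open>d dvd a j\<close> by (rule dvdE)
  obtain \<beta> where \<beta>: "b i = d * \<beta>" using \<open>d dvd b i\<close> by (rule dvdE)
  obtain k where k: "k \<in> {1..n}" "gcd d (a k) = 1" using D by (elim bexE)
  have "\<not> d dvd a k" using B_ii[rule_format, OF k(1)] k(2) by simp
  then have "\<not> d dvd b k" using B_i[rule_format, OF k(1)] by simp
  then have gcd_b: "gcd d (b k) = 1" using B_ii[rule_format, OF k(1)] by simp
  have "k \<noteq> i" "k \<noteq> j" using \<open>\<not> d dvd a k\<close> ij(3) \<open>d dvd a j\<close> by auto
  \<comment> \<open>The default value 1 freezes the remaining \<open>x\<close>-coordinates so that
    their parameters range over the \<open>d\<close>-th roots of unity.\<close>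
  define X :: "nat \<Rightarrow> 'a poly poly poly poly" where "X l = (if l = i then var_x\<^sub>1 else if l = j then var_x\<^sub>2
    else if l = n + 1 then var_y\<^sub>1 else if l = n + 2 then var_y\<^sub>2 else 1)" for l
  define pt where "pt y\<^sub>1 y\<^sub>2 x\<^sub>1 x\<^sub>2 l = ev y\<^sub>1 y\<^sub>2 x\<^sub>1 x\<^sub>2 (X l)"
    for y\<^sub>1 y\<^sub>2 x\<^sub>1 x\<^sub>2 l
  have pt: "\<And>l. l \<in> {1..n} - {i, j} \<Longrightarrow> pt y\<^sub>1 y\<^sub>2 x\<^sub>1 x\<^sub>2 l = 1" "pt y\<^sub>1 y\<^sub>2 x\<^sub>1 x\<^sub>2 i = x\<^sub>1"
    "pt y\<^sub>1 y\<^sub>2 x\<^sub>1 x\<^sub>2 j = x\<^sub>2" "pt y\<^sub>1 y\<^sub>2 x\<^sub>1 x\<^sub>2 (n + 1) = y\<^sub>1" "pt y\<^sub>1 y\<^sub>2 x\<^sub>1 x\<^sub>2 (n + 2) = y\<^sub>2" for y\<^sub>1 y\<^sub>2 x\<^sub>1 x\<^sub>2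
    using ij by (auto simp: pt_def X_def ev_simps ring_hom_1[OF ring_hom_ev])
  define M where "M = {z::'a. z ^ d = 1}"
  have d0: "d > 0" using d_gt_1 by simp
  have zeros: "ev y\<^sub>1 y\<^sub>2 x\<^sub>1 x\<^sub>2 (mpoly_subst f X) = 0 \<and> ev y\<^sub>1 y\<^sub>2 x\<^sub>1 x\<^sub>2 (mpoly_subst g X) = 0 \<longleftrightarrow>
      (\<exists>z\<in>M. y\<^sub>1 = z ^ a k * x\<^sub>2 ^ \<alpha> \<and> y\<^sub>2 = z ^ b k * x\<^sub>1 ^ \<beta>)" for y\<^sub>1 y\<^sub>2 x\<^sub>1 x\<^sub>2
  proof -
    let ?P = "restrict (pt y\<^sub>1 y\<^sub>2 x\<^sub>1 x\<^sub>2) {1..n + 2}"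
    have "ev y\<^sub>1 y\<^sub>2 x\<^sub>1 x\<^sub>2 (mpoly_subst h X) = mpoly_eval h ?P" if "h \<in> F" for h
      unfolding ev_mpoly_subst using that F(1)
      by (intro mpoly_eval_cong[of _ "n + 2"]) (auto simp: pt_def)
    then have "ev y\<^sub>1 y\<^sub>2 x\<^sub>1 x\<^sub>2 (mpoly_subst f X) = 0 \<and> ev y\<^sub>1 y\<^sub>2 x\<^sub>1 x\<^sub>2 (mpoly_subst g X) = 0 \<longleftrightarrow>
        ?P \<in> zero_set (n + 2) F"
      unfolding fg zero_set_def affine_space_def by auto
    also have "\<dots> \<longleftrightarrow> ?P \<in> simplicial_toric_variety n d a b"
      unfolding F(2) V_eq ..
    also have "\<dots> \<longleftrightarrow> (\<exists>z. z ^ d = 1 \<and> y\<^sub>1 = z ^ a k * x\<^sub>2 ^ \<alpha> \<and> y\<^sub>2 = z ^ b k * x\<^sub>1 ^ \<beta>)"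
      by (rule simplicial_toric_variety_slice[OF d0 ij(1,2) k(1) _ \<open>k \<noteq> i\<close> \<open>k \<noteq> j\<close> ij(3,6) \<alpha> \<beta> k(2) gcd_b C pt])
        (use ij in auto)
    finally show ?thesis by (simp add: M_def)
  qed
  have inj: "inj_on (\<lambda>z. z ^ m) M" if m: "gcd d m = 1" for m
  proof (rule inj_onI)
    fix y z assume "y \<in> M" "z \<in> M" "y ^ m = z ^ m"
    moreover obtain x where "\<And>z::'a. z ^ d = 1 \<Longrightarrow> (z ^ m) ^ x = z"
      using root_of_unity_coprime_power[OF m] by blast
    ultimately show "y = z" unfolding M_def mem_Collect_eq by metis
  qed
  obtain z :: 'a where z: "z \<noteq> 1" "z ^ p = 1"
    using nontrivial_root_of_unity_exists[OF p_prime char_ne] by blast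
  then have "z ^ d = 1" using p_dvd by (metis dvdE power_mult power_one)
  moreover have "\<alpha> > 0" "\<beta> > 0" using ij(4,5) \<alpha> \<beta> by auto
  ultimately show False
    using surfaces_meeting_at_point_not_two_equations[OF zeros, of 1 z] z(1) inj k(2) gcd_b
      finite_roots_of_unity[OF d0] by (auto simp: M_def)
qed

end
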